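(* For $0<d\le c\le b\le a$, $$\frac{a}{M_{\mathrm{KM}}(a,b,c,d)}=F_D\left(\frac14,\frac14,\frac14,\frac14,1;1-\frac{b^2}{a^2},1-\frac{c^2}{a^2},1-\frac{d^2}{a^2}\right)^2.$$
   Context: For $0<d\le c\le b\le a$ let $(a_0,b_0,c_0,d_0)=(a,b,c,d)$ and $a_{n+1}=\frac{a_n+b_n+c_n+d_n}{4}$, $b_{n+1}=\frac{\sqrt{(a_n+d_n)(b_n+c_n)}}{2}$, $c_{n+1}=\frac{\sqrt{(a_n+c_n)(b_n+d_n)}}{2}$, $d_{n+1}=\frac{\sqrt{(a_n+b_n)(c_n+d_n)}}{2}$ (positive roots). The four sequences converge to a common limit, denoted $M_{\mathrm{KM}}(a,b,c,d)$. The Lauricella hypergeometric series of type $D$ in three variables is $F_D(\alpha,\beta_1,\beta_2,\beta_3,\gamma;z_1,z_2,z_3)=\sum_{n_1,n_2,n_3\ge0}\frac{(\alpha,n_1+n_2+n_3)\prod_{j=1}^3(\beta_j,n_j)}{(\gamma,n_1+n_2+n_3)\prod_{j=1}^3(1,n_j)}\prod_{j=1}^3 z_j^{n_j}$, where $(\alpha,n)=\alpha(\alpha+1)\cdots(\alpha+n-1)$; it converges absolutely for $|z_j|<1$. *)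

theory Defs
  imports "HOL-Analysis.Analysis"
begin

definition km_step :: "real \<times> real \<times> real \<times> real \<Rightarrow> real \<times> real \<times> real \<times> real" where
  "km_step = (\<lambda>(a, b, c, d).
     ((a + b + c + d) / 4,
      sqrt ((a + d) * (b + c)) / 2,
      sqrt ((a + c) * (b + d)) / 2,
      sqrt ((a + b) * (c + d)) / 2))"

definition M_KM :: "real \<Rightarrow> real \<Rightarrow> real \<Rightarrow> real \<Rightarrow> real" where
  "M_KM a b c d =
     (THE L. (\<lambda>n. (km_step ^^ n) (a, b, c, d)) \<longlonglongrightarrow> (L, L, L, L))"

(* The triple series is an unordered sum over all multi-indices; it is meant for |z_j| < 1, where
   it converges absolutely. infsum is 0 when the family is not summable. *)
definition lauricella_FD ::
  "'a \<Rightarrow> 'a \<Rightarrow> 'a \<Rightarrow> 'a \<Rightarrow> 'a \<Rightarrow> 'a \<Rightarrow> 'a \<Rightarrow> 'a \<Rightarrow> 'a :: real_normed_field" where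
  "lauricella_FD \<alpha> \<beta>\<^sub>1 \<beta>\<^sub>2 \<beta>\<^sub>3 \<gamma> z\<^sub>1 z\<^sub>2 z\<^sub>3 =
     (\<Sum>\<^sub>\<infinity>(n\<^sub>1, n\<^sub>2, n\<^sub>3)\<in>UNIV.
        (pochhammer \<alpha> (n\<^sub>1 + n\<^sub>2 + n\<^sub>3) *
           (pochhammer \<beta>\<^sub>1 n\<^sub>1 * pochhammer \<beta>\<^sub>2 n\<^sub>2 * pochhammer \<beta>\<^sub>3 n\<^sub>3)) /
        (pochhammer \<gamma> (n\<^sub>1 + n\<^sub>2 + n\<^sub>3) *
           (pochhammer 1 n\<^sub>1 * pochhammer 1 n\<^sub>2 * pochhammer 1 n\<^sub>3)) *
        (z\<^sub>1 ^ n\<^sub>1 * z\<^sub>2 ^ n\<^sub>2 * z\<^sub>3 ^ n\<^sub>3))"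

end

theory Submission
  imports Defs
begin

text \<open>
  Euler's integral turns \<open>F\<^sub>D\<close> into \<open>I(x) = \<integral> t\<^bsup>-3/4\<^esup> (1 - t)\<^bsup>-1/4\<^esup> \<Prod>\<^sub>k (1 - t + t x\<^sub>k)\<^bsup>-1/4\<^esup> dt\<close> over
  \<open>[0, 1]\<close>, which is homogeneous of degree \<open>-1/4\<close> in four symmetric variables \<open>x\<^sub>k\<close>. The point is that
  \<open>I(a\<^sup>2, b\<^sup>2, c\<^sup>2, d\<^sup>2)\<close> is invariant under the mean iteration; it is then squeezed between its
  values on the diagonal, which converge to \<open>I(M\<^sup>2, M\<^sup>2, M\<^sup>2, M\<^sup>2)\<close>.

  For the invariance, join \<open>(a, b, c, d)\<close> to the diagonal point \<open>(m, m, m, m)\<close>, where \<open>m\<close> is the minimum,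
  by a straight line. The Euler-Darboux equations and the homogeneity of \<open>I\<close> give a linear system of
  ordinary differential equations for the gradient of \<open>I(a\<^sup>2, b\<^sup>2, c\<^sup>2, d\<^sup>2)\<close> along this line. The
  gradient of \<open>I\<close> pulled back by the squared mean step, a polynomial map, satisfies the same system and
  agrees at the diagonal point. The system has a regular singularity there, but its residue is a negative
  semidefinite graph Laplacian, so an energy estimate gives uniqueness.
\<close>

section \<open>Euler integrals over the Beta weight\<close>

text \<open>Differentiation under the integral sign. The mean value inequality bounds every
  difference quotient by \<open>g\<close>, so dominated convergence applies along each sequence of
  increments tending to 0.\<close>

lemma has_real_derivative_integral_dominated:
  fixes f f' :: "real \<Rightarrow> 'a \<Rightarrow> real"
  assumes "\<delta> > 0"
    and deriv: "\<And>\<theta> t. \<bar>\<theta> - \<theta>\<^sub>0\<bar> < \<delta> \<Longrightarrow> t \<in> space M \<Longrightarrow>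
      ((\<lambda>\<theta>. f \<theta> t) has_real_derivative f' \<theta> t) (at \<theta>)"
    and bound: "\<And>\<theta> t. \<bar>\<theta> - \<theta>\<^sub>0\<bar> < \<delta> \<Longrightarrow> t \<in> space M \<Longrightarrow> \<bar>f' \<theta> t\<bar> \<le> g t"
    and int: "\<And>\<theta>. \<bar>\<theta> - \<theta>\<^sub>0\<bar> < \<delta> \<Longrightarrow> integrable M (f \<theta>)"
    and meas: "f' \<theta>\<^sub>0 \<in> borel_measurable M"
    and g: "integrable M g"
  shows "((\<lambda>\<theta>. integral\<^sup>L M (f \<theta>)) has_real_derivative integral\<^sup>L M (f' \<theta>\<^sub>0)) (at \<theta>\<^sub>0)"
proof -
  have "((\<lambda>h. (integral\<^sup>L M (f (\<theta>\<^sub>0 + h)) - integral\<^sup>L M (f \<theta>\<^sub>0)) / h) \<longlongrightarrow> integral\<^sup>L M (f' \<theta>\<^sub>0)) (at 0)"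
    unfolding tendsto_at_iff_sequentially comp_def
  proof (intro allI impI)
    fix X :: "nat \<Rightarrow> real"
    assume X: "\<forall>i. X i \<in> UNIV - {0}" and lim: "X \<longlonglongrightarrow> 0"
    define q where "q n t = (f (\<theta>\<^sub>0 + X n) t - f \<theta>\<^sub>0 t) / X n" for n t
    \<comment> \<open>The bound on \<open>f'\<close> holds only for increments below
      \<open>\<delta>\<close>, so convergence is shown for the tail from \<open>N\<close> on and the
      shift is undone at the end.\<close>
    from lim \<open>\<delta> > 0\<close> obtain N where N: "\<And>n. n \<ge> N \<Longrightarrow> \<bar>X n\<bar> < \<delta>"
      by (auto simp: LIMSEQ_iff)
    have integral_q: "integral\<^sup>L M (q (n + N)) =
        (integral\<^sup>L M (f (\<theta>\<^sub>0 + X (n + N))) - integral\<^sup>L M (f \<theta>\<^sub>0)) / X (n + N)" for n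
      unfolding q_def using N[of "n + N"] \<open>\<delta> > 0\<close> by (simp add: int)
    have bound_q: "\<bar>q n t\<bar> \<le> g t" if "n \<ge> N" and t: "t \<in> space M" for n t
    proof -
      have "norm (f (\<theta>\<^sub>0 + X n) t - f \<theta>\<^sub>0 t) \<le> g t * norm (\<theta>\<^sub>0 + X n - \<theta>\<^sub>0)"
      proof (rule field_differentiable_bound[of "ball \<theta>\<^sub>0 \<delta>" "\<lambda>\<theta>. f \<theta> t" "\<lambda>\<theta>. f' \<theta> t"])
        show "((\<lambda>\<theta>. f \<theta> t) has_real_derivative f' z t) (at z within ball \<theta>\<^sub>0 \<delta>)"
          if "z \<in> ball \<theta>\<^sub>0 \<delta>" for z
          using deriv[of z t] that t
          by (auto simp: dist_real_def abs_minus_commute intro: has_field_derivative_at_within)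
      qed (use bound t N[OF \<open>n \<ge> N\<close>] \<open>\<delta> > 0\<close> in \<open>auto simp: dist_real_def abs_minus_commute\<close>)
      moreover have "X n \<noteq> 0"
        using X by auto
      ultimately show ?thesis
        by (simp add: q_def abs_divide divide_le_eq)
    qed
    have "(\<lambda>n. integral\<^sup>L M (q (n + N))) \<longlonglongrightarrow> integral\<^sup>L M (f' \<theta>\<^sub>0)"
    proof (rule integral_dominated_convergence[OF meas _ g])
      show "q (n + N) \<in> borel_measurable M" for n
        unfolding q_def using int[of "\<theta>\<^sub>0 + X (n + N)"] int[of \<theta>\<^sub>0] N[of "n + N"] \<open>\<delta> > 0\<close> by auto
      show "AE t in M. (\<lambda>n. q (n + N) t) \<longlonglongrightarrow> f' \<theta>\<^sub>0 t"
      proof (rule AE_I2)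
        fix t assume "t \<in> space M"
        then have "((\<lambda>h. (f (\<theta>\<^sub>0 + h) t - f \<theta>\<^sub>0 t) / h) \<longlongrightarrow> f' \<theta>\<^sub>0 t) (at 0)"
          using deriv[of \<theta>\<^sub>0 t] \<open>\<delta> > 0\<close> by (simp add: DERIV_def)
        then have "(\<lambda>n. q n t) \<longlonglongrightarrow> f' \<theta>\<^sub>0 t"
          using X lim by (auto simp: tendsto_at_iff_sequentially comp_def q_def)
        then show "(\<lambda>n. q (n + N) t) \<longlonglongrightarrow> f' \<theta>\<^sub>0 t"
          by (rule LIMSEQ_ignore_initial_segment)
      qed
      show "AE t in M. norm (q (n + N) t) \<le> g t" for n
        using bound_q by auto
    qed
    then have "(\<lambda>n. (integral\<^sup>L M (f (\<theta>\<^sub>0 + X (n + N))) - integral\<^sup>L M (f \<theta>\<^sub>0)) / X (n + N))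
        \<longlonglongrightarrow> integral\<^sup>L M (f' \<theta>\<^sub>0)"
      unfolding integral_q .
    then show "(\<lambda>n. (integral\<^sup>L M (f (\<theta>\<^sub>0 + X n)) - integral\<^sup>L M (f \<theta>\<^sub>0)) / X n)
        \<longlonglongrightarrow> integral\<^sup>L M (f' \<theta>\<^sub>0)"
      by (rule LIMSEQ_offset)
  qed
  then show ?thesis
    by (simp add: DERIV_def)
qed

text \<open>The indicator lets all integrals run over the whole line and confines pointwise
  arguments to 0 < t < 1.\<close>

definition beta_weight :: "real \<Rightarrow> real \<Rightarrow> real \<Rightarrow> real" where
  "beta_weight a b t = indicator {0<..<1} t * (t powr (a - 1) * (1 - t) powr (b - 1))"

text \<open>Each factor interpolates between 1 and \<open>x k\<close>, so it is positive on [0, 1]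
  for every positive \<open>x k\<close>; with equal exponents the kernel is symmetric in the
  variables.\<close>

definition euler_kernel :: "('n::finite \<Rightarrow> real) \<Rightarrow> ('n \<Rightarrow> real) \<Rightarrow> real \<Rightarrow> real" where
  "euler_kernel \<beta> x t = (\<Prod>k\<in>UNIV. (1 - t + t * x k) powr (- \<beta> k))"

definition euler_integral :: "real \<Rightarrow> real \<Rightarrow> ('n::finite \<Rightarrow> real) \<Rightarrow> ('n \<Rightarrow> real) \<Rightarrow> real" where
  "euler_integral a b \<beta> x = (\<integral>t. beta_weight a b t * euler_kernel \<beta> x t \<partial>lborel)"

lemma beta_weight_measurable [measurable]: "beta_weight a b \<in> borel_measurable borel"
  unfolding beta_weight_def by measurable

lemma beta_weight_nonneg: "beta_weight a b t \<ge> 0"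
  by (simp add: beta_weight_def)

text \<open>The classical Beta integral is available as a gauge integral over an interval;
  nonnegativity of the weight turns it into a Lebesgue integral over the line.\<close>

lemma has_bochner_integral_beta_weight:
  assumes "a > 0" "b > 0"
  shows "has_bochner_integral lborel (beta_weight a b) (Beta a b)"
proof -
  have "((\<lambda>t. t powr (a - 1) * (1 - t) powr (b - 1)) has_integral Beta a b) {0<..<1}"
    using has_integral_Beta_real[OF assms] by (simp add: has_integral_Icc_iff_Ioo)
  then have "((\<lambda>t. if t \<in> {0<..<1} then t powr (a - 1) * (1 - t) powr (b - 1) else 0) has_integral Beta a b) UNIV"
    by (simp only: has_integral_restrict_UNIV)
  moreover have "(\<lambda>t. if t \<in> {0<..<1} then t powr (a - 1) * (1 - t) powr (b - 1) else 0) = beta_weight a b"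
    by (auto simp: beta_weight_def fun_eq_iff)
  ultimately have "(beta_weight a b has_integral Beta a b) UNIV"
    by simp
  moreover have "Beta a b \<ge> 0"
    using assms Gamma_real_pos[of a] Gamma_real_pos[of b] Gamma_real_pos[of "a + b"]
    by (simp add: Beta_def)
  ultimately show ?thesis
    by (intro has_bochner_integral_nn_integral)
      (auto simp: beta_weight_nonneg nn_integral_has_integral_lborel)
qed

lemma beta_weight_eq_0: "t \<notin> {0<..<1} \<Longrightarrow> beta_weight a b t = 0"
  by (simp add: beta_weight_def)

lemma beta_weight_Suc: "beta_weight (a + 1) b t = t * beta_weight a b t"
  by (auto simp: beta_weight_def indicator_def powr_diff)

lemma interpolation_pos:
  fixes x t :: real
  assumes "x > 0" "0 \<le> t" "t \<le> 1"
  shows "1 - t + t * x > 0"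
  using assms by (cases "t = 1") (auto intro: add_pos_nonneg)

lemma euler_kernel_measurable [measurable]: "euler_kernel \<beta> x \<in> borel_measurable borel"
  unfolding euler_kernel_def by measurable

text \<open>Logarithmic differentiation. The product equals the exponential of a sum of logarithms
  only where all factors are positive, which by continuity is a neighbourhood of \<theta>.\<close>

lemma has_real_derivative_prod_powr:
  fixes p :: "'n::finite \<Rightarrow> real \<Rightarrow> real"
  assumes pos: "\<And>k. p k \<theta> > 0"
    and deriv: "\<And>k. (p k has_real_derivative p' k) (at \<theta>)"
  shows "((\<lambda>\<theta>. \<Prod>k\<in>UNIV. p k \<theta> powr (- \<beta> k)) has_real_derivative
    - (\<Sum>k\<in>UNIV. \<beta> k * p' k / p k \<theta>) * (\<Prod>k\<in>UNIV. p k \<theta> powr (- \<beta> k))) (at \<theta>)"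
proof -
  have eq: "(\<Prod>k\<in>UNIV. p k \<eta> powr (- \<beta> k)) = exp (- (\<Sum>k\<in>UNIV. \<beta> k * ln (p k \<eta>)))"
    if "\<forall>k. p k \<eta> > 0" for \<eta>
    using that by (simp add: powr_def less_imp_neq[symmetric] flip: exp_sum sum_negf)
  have "((\<lambda>\<theta>. ln (p k \<theta>)) has_real_derivative inverse (p k \<theta>) * p' k) (at \<theta>)" for k
    using pos deriv by (intro DERIV_chain2[where f = ln and g = "p k"] DERIV_ln)
  then have 1: "((\<lambda>\<theta>. exp (- (\<Sum>k\<in>UNIV. \<beta> k * ln (p k \<theta>)))) has_real_derivative
      exp (- (\<Sum>k\<in>UNIV. \<beta> k * ln (p k \<theta>))) *
      (- (\<Sum>k\<in>UNIV. \<beta> k * (inverse (p k \<theta>) * p' k)))) (at \<theta>)"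
    by (intro DERIV_fun_exp DERIV_minus DERIV_sum DERIV_cmult)
  have "eventually (\<lambda>\<eta>. p k \<eta> > 0) (nhds \<theta>)" for k
    using DERIV_isCont[OF deriv[of k]] pos[of k]
    by (auto simp: isCont_def tendsto_at_iff_tendsto_nhds dest: order_tendstoD)
  then have "eventually (\<lambda>\<eta>. \<forall>k. p k \<eta> > 0) (nhds \<theta>)"
    by (simp add: eventually_all_finite)
  then have "eventually (\<lambda>\<eta>. (\<Prod>k\<in>UNIV. p k \<eta> powr (- \<beta> k)) =
      exp (- (\<Sum>k\<in>UNIV. \<beta> k * ln (p k \<eta>)))) (nhds \<theta>)"
    by eventually_elim (rule eq)
  from DERIV_cong_ev[OF refl this refl, THEN iffD2, OF 1] show ?thesis
    using eq[of \<theta>] pos by (simp add: field_simps)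
qed

lemma euler_kernel_upd:
  assumes "\<And>k. x k > 0" "0 \<le> t" "t \<le> 1"
  shows "euler_kernel (\<beta>(i := \<beta> i + 1)) x t = euler_kernel \<beta> x t / (1 - t + t * x i)"
proof -
  have pos: "1 - t + t * x i > 0"
    by (rule interpolation_pos) (use assms in auto)
  have "euler_kernel (\<beta>(i := \<beta> i + 1)) x t =
      (1 - t + t * x i) powr (- \<beta> i - 1) *
      (\<Prod>k\<in>UNIV - {i}. (1 - t + t * x k) powr (- \<beta> k))"
    unfolding euler_kernel_def by (subst prod.remove[of _ i]) auto
  moreover have "euler_kernel \<beta> x t =
      (1 - t + t * x i) powr (- \<beta> i) *
      (\<Prod>k\<in>UNIV - {i}. (1 - t + t * x k) powr (- \<beta> k))"
    unfolding euler_kernel_def by (subst prod.remove[of _ i]) auto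
  ultimately show ?thesis
    using pos by (simp add: powr_diff)
qed

lemma continuous_on_euler_kernel:
  assumes "\<And>k. x k > 0"
  shows "continuous_on {0..1} (euler_kernel \<beta> x)"
  unfolding euler_kernel_def
  by (intro continuous_intros) (use interpolation_pos[OF assms] in \<open>force simp: less_le\<close>)

text \<open>The kernel is continuous, hence bounded, on [0, 1], so a multiple of the Beta weight
  dominates the integrand.\<close>

lemma integrable_euler_kernel:
  assumes "a > 0" "b > 0" "\<And>k. x k > 0"
  shows "integrable lborel (\<lambda>t. beta_weight a b t * euler_kernel \<beta> x t)"
proof -
  have "compact (euler_kernel \<beta> x ` {0..1})"
    by (intro compact_continuous_image continuous_on_euler_kernel assms) auto
  then obtain C where C: "\<And>t. t \<in> {0..1} \<Longrightarrow> \<bar>euler_kernel \<beta> x t\<bar> \<le> C"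
    by (force simp: bounded_iff dest!: compact_imp_bounded)
  show ?thesis
  proof (rule Bochner_Integration.integrable_bound)
    show "integrable lborel (\<lambda>t. beta_weight a b t * C)"
      using has_bochner_integral_beta_weight[OF assms(1,2)]
      by (intro integrable_mult_left) (auto simp: has_bochner_integral_iff)
    have "norm (beta_weight a b t * euler_kernel \<beta> x t) \<le> norm (beta_weight a b t * C)" for t
      using C[of t] by (cases "t \<in> {0<..<1}")
        (auto simp: beta_weight_eq_0 abs_mult intro!: mult_left_mono)
    then show "AE t in lborel. norm (beta_weight a b t * euler_kernel \<beta> x t) \<le> norm (beta_weight a b t * C)"
      by simp
  qed simp
qed

text \<open>Raising \<open>a\<close> and \<open>\<beta> i\<close> together inserts the factor t / (1
  - t + t x_i). Differentiating the kernel in x_i produces the same factor, times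
  \<open>- \<beta> i\<close>.\<close>

lemma euler_integral_upd:
  assumes "\<And>k. x k > 0"
  shows "euler_integral (a + 1) b (\<beta>(i := \<beta> i + 1)) x =
    (\<integral>t. beta_weight a b t * (t / (1 - t + t * x i) * euler_kernel \<beta> x t) \<partial>lborel)"
  unfolding euler_integral_def
proof (rule Bochner_Integration.integral_cong[OF refl])
  fix t :: real
  show "beta_weight (a + 1) b t * euler_kernel (\<beta>(i := \<beta> i + 1)) x t =
      beta_weight a b t * (t / (1 - t + t * x i) * euler_kernel \<beta> x t)"
    by (cases "t \<in> {0<..<1}")
      (auto simp: beta_weight_eq_0 euler_kernel_upd[where x = x and \<beta> = \<beta> and i = i] assms beta_weight_Suc)
qed

lemma integrable_euler_upd:
  assumes "a > 0" "b > 0" "\<And>k. x k > 0"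
  shows "integrable lborel (\<lambda>t. beta_weight a b t * (t / (1 - t + t * x i) * euler_kernel \<beta> x t))"
proof (rule Bochner_Integration.integrable_cong[THEN iffD1, OF refl])
  show "integrable lborel (\<lambda>t. beta_weight (a + 1) b t * euler_kernel (\<beta>(i := \<beta> i + 1)) x t)"
    using assms by (intro integrable_euler_kernel) auto
  show "beta_weight (a + 1) b t * euler_kernel (\<beta>(i := \<beta> i + 1)) x t =
      beta_weight a b t * (t / (1 - t + t * x i) * euler_kernel \<beta> x t)" for t
    by (cases "t \<in> {0<..<1}")
      (auto simp: beta_weight_eq_0 euler_kernel_upd[where x = x and \<beta> = \<beta> and i = i] assms beta_weight_Suc)
qed

lemma euler_integral_antimono:
  assumes "a > 0" "b > 0" "\<And>k. 0 < x k" "\<And>k. x k \<le> y k" "\<And>k. \<beta> k \<ge> 0"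
  shows "euler_integral a b \<beta> y \<le> euler_integral a b \<beta> x"
  unfolding euler_integral_def
proof (rule integral_mono)
  have ypos: "y k > 0" for k
    using assms(3,4)[of k] by linarith
  show "integrable lborel (\<lambda>t. beta_weight a b t * euler_kernel \<beta> x t)"
    and "integrable lborel (\<lambda>t. beta_weight a b t * euler_kernel \<beta> y t)"
    by (intro integrable_euler_kernel assms ypos)+
  show "beta_weight a b t * euler_kernel \<beta> y t \<le> beta_weight a b t * euler_kernel \<beta> x t" for t
  proof (cases "t \<in> {0<..<1}")
    case True
    have "euler_kernel \<beta> y t \<le> euler_kernel \<beta> x t"
      unfolding euler_kernel_def
    proof (intro prod_mono conjI powr_mono2')
      show "1 - t + t * x k > 0" for k
        by (rule interpolation_pos) (use assms True in auto)
    qed (use assms True in auto)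
    then show ?thesis
      by (intro mult_left_mono beta_weight_nonneg)
  qed (simp add: beta_weight_eq_0)
qed

section \<open>Derivatives of Euler integrals and the linear relations between them\<close>

lemma euler_kernel_has_real_derivative_curve:
  assumes "\<And>k. x k \<theta> > 0" "0 \<le> t" "t \<le> 1"
    and "\<And>k. (x k has_real_derivative x' k) (at \<theta>)"
  shows "((\<lambda>\<theta>. euler_kernel \<beta> (\<lambda>k. x k \<theta>) t) has_real_derivative
    - (\<Sum>k\<in>UNIV. \<beta> k * x' k * (t / (1 - t + t * x k \<theta>) * euler_kernel \<beta> (\<lambda>k. x k \<theta>) t))) (at \<theta>)"
proof -
  have "1 - t + t * x k \<theta> > 0" for k
    by (rule interpolation_pos) (use assms in auto)
  moreover have "((\<lambda>\<theta>. 1 - t + t * x k \<theta>) has_real_derivative t * x' k) (at \<theta>)" for k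
    using DERIV_add[OF DERIV_const[of "1 - t"] DERIV_cmult[OF assms(4)[of k], of t]] by simp
  ultimately have "((\<lambda>\<theta>. euler_kernel \<beta> (\<lambda>k. x k \<theta>) t) has_real_derivative
    - (\<Sum>k\<in>UNIV. \<beta> k * (t * x' k) / (1 - t + t * x k \<theta>)) * euler_kernel \<beta> (\<lambda>k. x k \<theta>) t) (at \<theta>)"
    unfolding euler_kernel_def by (rule has_real_derivative_prod_powr)
  then show ?thesis
    by (simp add: sum_distrib_left sum_distrib_right mult_ac)
qed

text \<open>The derivative of the exponent raises both \<open>a\<close> and one \<open>\<beta>\<close>, so that all derivatives
  stay within the same family.\<close>
lemma euler_integral_has_real_derivative_curve:
  fixes x x' :: "'n::finite \<Rightarrow> real \<Rightarrow> real"
  assumes "a > 0" "b > 0" "open U" "\<theta>\<^sub>0 \<in> U"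
    and pos: "\<And>k \<theta>. \<theta> \<in> U \<Longrightarrow> x k \<theta> > 0"
    and deriv: "\<And>k \<theta>. \<theta> \<in> U \<Longrightarrow> (x k has_real_derivative x' k \<theta>) (at \<theta>)"
    and cont: "\<And>k. continuous_on U (x' k)"
  shows "((\<lambda>\<theta>. euler_integral a b \<beta> (\<lambda>k. x k \<theta>)) has_real_derivative
    - (\<Sum>k\<in>UNIV. \<beta> k * x' k \<theta>\<^sub>0 *
        euler_integral (a + 1) b (\<beta>(k := \<beta> k + 1)) (\<lambda>k. x k \<theta>\<^sub>0))) (at \<theta>\<^sub>0)"
proof -
  define f where "f \<theta> t = beta_weight a b t * euler_kernel \<beta> (\<lambda>k. x k \<theta>) t" for \<theta> t
  define h where "h = (\<lambda>(\<theta>, t). - (\<Sum>k\<in>UNIV. \<beta> k * x' k \<theta> *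
    (t / (1 - t + t * x k \<theta>) * euler_kernel \<beta> (\<lambda>k. x k \<theta>) t)))"
  define f' where "f' \<theta> t = beta_weight a b t * h (\<theta>, t)" for \<theta> t
  obtain \<delta> where \<delta>: "\<delta> > 0" "cball \<theta>\<^sub>0 \<delta> \<subseteq> U"
    using \<open>open U\<close> \<open>\<theta>\<^sub>0 \<in> U\<close> open_contains_cball by blast
  have in_U: "\<theta> \<in> U" if "\<bar>\<theta> - \<theta>\<^sub>0\<bar> < \<delta>" for \<theta>
    using that \<delta> by (auto simp: subset_iff dist_real_def abs_minus_commute)
  have contx: "continuous_on U (x k)" for k
    using deriv by (meson DERIV_continuous_on has_field_derivative_at_within)
  \<comment> \<open>Joint continuity on a compact set bounds the derivative uniformly in the
    parameter, which supplies the dominating function \<open>beta_weight a b t * C\<close>.\<close>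
  have "continuous_on (cball \<theta>\<^sub>0 \<delta> \<times> {0..1}) h"
    unfolding h_def euler_kernel_def case_prod_beta
    by (intro continuous_intros continuous_on_compose2[OF contx] continuous_on_compose2[OF cont])
      (use interpolation_pos[OF pos] \<delta> in \<open>force simp: less_le\<close>)+
  then have "compact (h ` (cball \<theta>\<^sub>0 \<delta> \<times> {0..1}))"
    by (intro compact_continuous_image compact_Times) auto
  then obtain C where C: "\<And>\<theta> t. \<theta> \<in> cball \<theta>\<^sub>0 \<delta> \<Longrightarrow> t \<in> {0..1} \<Longrightarrow> \<bar>h (\<theta>, t)\<bar> \<le> C"
    by (force simp: bounded_iff dest!: compact_imp_bounded)
  have "((\<lambda>\<theta>. integral\<^sup>L lborel (f \<theta>)) has_real_derivative integral\<^sup>L lborel (f' \<theta>\<^sub>0)) (at \<theta>\<^sub>0)"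
  proof (rule has_real_derivative_integral_dominated[OF \<open>\<delta> > 0\<close>, where g = "\<lambda>t. beta_weight a b t * C"])
    fix \<theta> t :: real assume \<theta>: "\<bar>\<theta> - \<theta>\<^sub>0\<bar> < \<delta>"
    show "((\<lambda>\<theta>. f \<theta> t) has_real_derivative f' \<theta> t) (at \<theta>)"
    proof (cases "t \<in> {0<..<1}")
      case True
      then show ?thesis
        unfolding f_def f'_def h_def prod.case
        by (intro DERIV_cmult euler_kernel_has_real_derivative_curve pos deriv in_U[OF \<theta>]) auto
    qed (simp add: f_def f'_def beta_weight_eq_0)
    show "\<bar>f' \<theta> t\<bar> \<le> beta_weight a b t * C"
      using C[of \<theta> t] \<theta> by (cases "t \<in> {0<..<1}")
        (auto simp: f'_def beta_weight_eq_0 abs_mult beta_weight_nonneg dist_real_def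
          abs_minus_commute intro!: mult_left_mono)
  next
    fix \<theta> :: real assume \<theta>: "\<bar>\<theta> - \<theta>\<^sub>0\<bar> < \<delta>"
    show "integrable lborel (f \<theta>)"
      unfolding f_def by (intro integrable_euler_kernel assms in_U[OF \<theta>])
  next
    show "f' \<theta>\<^sub>0 \<in> borel_measurable lborel"
      unfolding f'_def h_def prod.case by measurable
    show "integrable lborel (\<lambda>t. beta_weight a b t * C)"
      using has_bochner_integral_beta_weight[OF assms(1,2)]
      by (intro integrable_mult_left) (auto simp: has_bochner_integral_iff)
  qed
  moreover have "integral\<^sup>L lborel (f' \<theta>\<^sub>0) = - (\<Sum>k\<in>UNIV. \<beta> k * x' k \<theta>\<^sub>0 *
        euler_integral (a + 1) b (\<beta>(k := \<beta> k + 1)) (\<lambda>k. x k \<theta>\<^sub>0))"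
  proof -
    have "f' \<theta>\<^sub>0 = (\<lambda>t. - (\<Sum>k\<in>UNIV. \<beta> k * x' k \<theta>\<^sub>0 * (beta_weight a b t *
        (t / (1 - t + t * x k \<theta>\<^sub>0) * euler_kernel \<beta> (\<lambda>k. x k \<theta>\<^sub>0) t))))"
      by (simp add: fun_eq_iff f'_def h_def sum_distrib_left mult_ac)
    moreover have "(\<integral>t. - (\<Sum>k\<in>UNIV. \<beta> k * x' k \<theta>\<^sub>0 * (beta_weight a b t *
        (t / (1 - t + t * x k \<theta>\<^sub>0) * euler_kernel \<beta> (\<lambda>k. x k \<theta>\<^sub>0) t))) \<partial>lborel) =
      - (\<Sum>k\<in>UNIV. \<beta> k * x' k \<theta>\<^sub>0 * (\<integral>t. beta_weight a b t *
        (t / (1 - t + t * x k \<theta>\<^sub>0) * euler_kernel \<beta> (\<lambda>k. x k \<theta>\<^sub>0) t) \<partial>lborel))"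
      by (subst integral_minus, subst Bochner_Integration.integral_sum)
        (intro integrable_mult_right integrable_euler_upd pos assms, simp only: integral_mult_right_zero)
    moreover have "(\<integral>t. beta_weight a b t *
        (t / (1 - t + t * x k \<theta>\<^sub>0) * euler_kernel \<beta> (\<lambda>k. x k \<theta>\<^sub>0) t) \<partial>lborel) =
        euler_integral (a + 1) b (\<beta>(k := \<beta> k + 1)) (\<lambda>k. x k \<theta>\<^sub>0)" for k
      by (rule euler_integral_upd[symmetric]) (intro pos assms)
    ultimately show ?thesis
      by simp
  qed
  ultimately show ?thesis
    by (simp add: f_def[abs_def] euler_integral_def)
qed

text \<open>This is 1/p - 1/q = (q - p)/(p q) under the integral, with q - p = t (x_j - x_i). Read
  as a statement on derivatives, it is the Euler-Darboux equation: mixed second derivatives reduce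
  to first ones.\<close>

lemma euler_integral_partial_fraction:
  fixes x :: "'n::finite \<Rightarrow> real"
  assumes "a > 0" "b > 0" "\<And>k. x k > 0"
  defines "\<gamma> i \<equiv> \<lambda>\<beta>. \<beta>(i := \<beta> i + 1)"
  shows "(x j - x i) * euler_integral (a + 1) b (\<gamma> j (\<gamma> i \<beta>)) x =
    euler_integral a b (\<gamma> i \<beta>) x - euler_integral a b (\<gamma> j \<beta>) x"
proof -
  let ?e = "\<lambda>\<beta> t. beta_weight a b t * euler_kernel \<beta> x t"
  have "euler_integral a b (\<gamma> i \<beta>) x - euler_integral a b (\<gamma> j \<beta>) x =
      (\<integral>t. ?e (\<gamma> i \<beta>) t - ?e (\<gamma> j \<beta>) t \<partial>lborel)"
    unfolding euler_integral_def
    by (rule Bochner_Integration.integral_diff[symmetric]) (intro integrable_euler_kernel assms)+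
  also have "\<dots> = (\<integral>t. (x j - x i) * (beta_weight (a + 1) b t * euler_kernel (\<gamma> j (\<gamma> i \<beta>)) x t) \<partial>lborel)"
  proof (rule Bochner_Integration.integral_cong[OF refl])
    fix t :: real
    show "?e (\<gamma> i \<beta>) t - ?e (\<gamma> j \<beta>) t =
        (x j - x i) * (beta_weight (a + 1) b t * euler_kernel (\<gamma> j (\<gamma> i \<beta>)) x t)"
    proof (cases "t \<in> {0<..<1}")
      case True
      then have pos: "1 - t + t * x k > 0" for k
        by (intro interpolation_pos assms) auto
      have upd: "euler_kernel (\<gamma> k \<beta>) x t = euler_kernel \<beta> x t / (1 - t + t * x k)" for k \<beta>
        unfolding \<gamma>_def using True assms by (intro euler_kernel_upd) auto
      have "w * (e / p) - w * (e / q) = (y - z) * (t * w * (e / p / q))"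
        if "p > 0" "q > 0" "p = 1 - t + t * z" "q = 1 - t + t * y" for w e p q y z :: real
      proof -
        have "w * (e / p) - w * (e / q) = w * e * (q - p) / (p * q)"
          using that(1,2) by (simp add: field_simps)
        also have "q - p = t * (y - z)"
          by (simp add: that algebra_simps)
        finally show ?thesis
          by simp
      qed
      from this[OF pos[of i] pos[of j] refl refl] show ?thesis
        by (simp add: upd beta_weight_Suc)
    qed (simp add: beta_weight_eq_0)
  qed
  finally show ?thesis
    by (simp add: euler_integral_def)
qed

text \<open>Euler's identity for degree -a. It comes from integrating the derivative of t^a (1 -
  t)^b times the kernel, a function that vanishes at both end points.\<close>

lemma euler_integral_homogeneity:
  fixes x :: "'n::finite \<Rightarrow> real"
  assumes "a > 0" "b > 0" "\<And>k. x k > 0" and sum: "(\<Sum>k\<in>UNIV. \<beta> k) = a + b"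
  shows "(\<Sum>k\<in>UNIV. \<beta> k * x k * euler_integral (a + 1) b (\<beta>(k := \<beta> k + 1)) x) =
    a * euler_integral a b \<beta> x"
proof -
  define G where "G t = t powr a * (1 - t) powr b * euler_kernel \<beta> x t" for t
  define g where "g t = a * (beta_weight a b t * euler_kernel \<beta> x t) -
    (\<Sum>k\<in>UNIV. \<beta> k * x k * (beta_weight a b t * (t / (1 - t + t * x k) * euler_kernel \<beta> x t)))" for t
  have "(g has_integral G 1 - G 0) {0..1}"
  proof (rule fundamental_theorem_of_calculus_interior)
    show "continuous_on {0..1} G"
      unfolding G_def
      by (intro continuous_intros continuous_on_powr' continuous_on_euler_kernel assms)
        (use assms in auto)
    fix t :: real assume "t \<in> {0<..<1}"
    then have t: "0 < t" "t < 1" by auto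
    have pos: "1 - t + t * x k > 0" for k
      by (rule interpolation_pos) (use assms t in auto)
    define K where "K = euler_kernel \<beta> x t"
    define S where "S = (\<Sum>k\<in>UNIV. \<beta> k * (x k - 1) / (1 - t + t * x k))"
    have dK: "(euler_kernel \<beta> x has_real_derivative - S * K) (at t)"
      unfolding euler_kernel_def[abs_def] S_def K_def
      by (intro has_real_derivative_prod_powr pos) (auto intro!: derivative_eq_intros)
    have dw: "((\<lambda>t. t powr a * (1 - t) powr b) has_real_derivative
        a * t powr (a - 1) * (1 - t) powr b - t powr a * (b * (1 - t) powr (b - 1))) (at t)"
      using t by (auto intro!: derivative_eq_intros)
    have "(G has_real_derivative
        (a * t powr (a - 1) * (1 - t) powr b - t powr a * (b * (1 - t) powr (b - 1))) * K +
        - S * K * (t powr a * (1 - t) powr b)) (at t)"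
      using DERIV_mult[OF dw dK] unfolding G_def[abs_def] K_def .
    moreover have "(a * t powr (a - 1) * (1 - t) powr b - t powr a * (b * (1 - t) powr (b - 1))) * K +
        - S * K * (t powr a * (1 - t) powr b) = g t"
    proof -
      define w where "w = t powr (a - 1) * (1 - t) powr (b - 1)"
      have w: "t powr a = t * t powr (a - 1)" "(1 - t) powr b = (1 - t) * (1 - t) powr (b - 1)"
        using t by (simp_all add: powr_diff)
      \<comment> \<open>Since the exponents add up to \<open>a + b\<close>, the terms linear in t
        cancel in the derivative and only the constant \<open>a\<close> and the sum in
        \<open>g\<close> remain.\<close>
      have "(1 - t) * (t * S) = (\<Sum>k\<in>UNIV. \<beta> k * (- t + t * x k / (1 - t + t * x k)))"
        unfolding S_def sum_distrib_left
      proof (rule sum.cong[OF refl])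
        fix k
        show "(1 - t) * (t * (\<beta> k * (x k - 1) / (1 - t + t * x k))) =
            \<beta> k * (- t + t * x k / (1 - t + t * x k))"
          using pos[of k] by (simp add: divide_simps) (simp add: algebra_simps)
      qed
      also have "\<dots> = - (a + b) * t + (\<Sum>k\<in>UNIV. \<beta> k * (t * x k / (1 - t + t * x k)))"
        by (simp add: ring_distribs sum_subtractf sum flip: sum_distrib_right)
      finally have S: "(1 - t) * (t * S) = - (a + b) * t + (\<Sum>k\<in>UNIV. \<beta> k * (t * x k / (1 - t + t * x k)))" .
      have "(a * t powr (a - 1) * (1 - t) powr b - t powr a * (b * (1 - t) powr (b - 1))) * K +
          - S * K * (t powr a * (1 - t) powr b) = w * K * (a * (1 - t) - b * t - (1 - t) * (t * S))"
        unfolding w w_def by (simp add: algebra_simps)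
      also have "\<dots> = g t"
        unfolding S g_def using t
        by (simp add: w_def K_def beta_weight_def sum_distrib_left algebra_simps)
      finally show ?thesis .
    qed
    ultimately show "(G has_vector_derivative g t) (at t)"
      by (simp add: has_real_derivative_iff_has_vector_derivative)
  qed simp
  then have "(g has_integral 0) {0..1}"
    using assms by (simp add: G_def)
  then have "(g has_integral 0) UNIV"
    by (rule has_integral_on_superset) (auto simp: g_def beta_weight_eq_0)
  moreover have int: "integrable lborel g"
    unfolding g_def
    by (intro Bochner_Integration.integrable_diff Bochner_Integration.integrable_sum
        integrable_mult_right integrable_euler_kernel integrable_euler_upd assms)
  ultimately have "integral\<^sup>L lborel g = 0"
    using has_integral_integral_lborel[OF int] has_integral_unique by blast
  moreover have "integral\<^sup>L lborel g = a * euler_integral a b \<beta> x -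
      (\<Sum>k\<in>UNIV. \<beta> k * x k * euler_integral (a + 1) b (\<beta>(k := \<beta> k + 1)) x)"
    unfolding g_def euler_integral_upd[of x, OF assms(3)] euler_integral_def[of a b \<beta> x]
    by (subst Bochner_Integration.integral_diff, (intro Bochner_Integration.integrable_sum
        integrable_mult_right integrable_euler_kernel integrable_euler_upd assms)+)
      (subst Bochner_Integration.integral_sum, (intro
        integrable_mult_right integrable_euler_upd assms), simp only: integral_mult_right_zero)
  ultimately show ?thesis
    by simp
qed

text \<open>By Euler's identity, s^a times the integral at s x has zero derivative in s, so it is
  constant on the positive half-line.\<close>

lemma euler_integral_scale:
  fixes x :: "'n::finite \<Rightarrow> real"
  assumes "a > 0" "b > 0" "\<And>k. x k > 0" and sum: "(\<Sum>k\<in>UNIV. \<beta> k) = a + b" and "c > 0"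
  shows "euler_integral a b \<beta> (\<lambda>k. c * x k) = c powr (- a) * euler_integral a b \<beta> x"
proof -
  define f where "f s = s powr a * euler_integral a b \<beta> (\<lambda>k. s * x k)" for s
  have "(f has_real_derivative 0) (at s)" if "s \<in> {0<..}" for s
  proof -
    from that have "s > 0" by simp
    have dI: "((\<lambda>s. euler_integral a b \<beta> (\<lambda>k. s * x k)) has_real_derivative
        - (\<Sum>k\<in>UNIV. \<beta> k * x k * euler_integral (a + 1) b (\<beta>(k := \<beta> k + 1)) (\<lambda>k. s * x k))) (at s)"
      by (rule euler_integral_has_real_derivative_curve[where U = "{0<..}"])
        (use assms \<open>s > 0\<close> in \<open>auto intro!: derivative_eq_intros\<close>)
    have euler: "(\<Sum>k\<in>UNIV. \<beta> k * x k * euler_integral (a + 1) b (\<beta>(k := \<beta> k + 1)) (\<lambda>k. s * x k)) =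
        a / s * euler_integral a b \<beta> (\<lambda>k. s * x k)"
      using euler_integral_homogeneity[of a b "\<lambda>k. s * x k" \<beta>] assms \<open>s > 0\<close>
      by (simp add: field_simps sum_distrib_left)
    have dp: "((\<lambda>s. s powr a) has_real_derivative a * s powr (a - 1)) (at s)"
      using \<open>s > 0\<close> by (auto intro!: derivative_eq_intros)
    have "(f has_real_derivative
        a * s powr (a - 1) * euler_integral a b \<beta> (\<lambda>k. s * x k) +
        - (a / s * euler_integral a b \<beta> (\<lambda>k. s * x k)) * s powr a) (at s)"
      using DERIV_mult[OF dp dI] unfolding f_def[abs_def] euler .
    then show ?thesis
      using \<open>s > 0\<close> by (simp add: powr_diff)
  qed
  then obtain C where C: "\<And>s. s \<in> {0<..} \<Longrightarrow> f s = C"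
    using has_field_derivative_zero_constant[of "{0<..}" f]
    by (auto intro: has_field_derivative_at_within)
  have "f c = f 1"
    using C \<open>c > 0\<close> by simp
  then show ?thesis
    using \<open>c > 0\<close> by (simp add: f_def powr_minus field_simps)
qed

section \<open>A singular linear system\<close>

text \<open>The matrix \<open>A\<^sub>i A\<^sub>k / (A\<^sub>i + A\<^sub>k)\<close> acts on \<open>D\<close> as a weighted graph Laplacian. It is positive
  semidefinite, so the energy \<open>\<Sum>A\<^sub>i\<^sup>2 D\<^sub>i\<^sup>2\<close> cannot grow in spite of the pole at \<open>t = 0\<close>.\<close>
lemma singular_system_unique:
  fixes D D' :: "'n::finite \<Rightarrow> real \<Rightarrow> real" and e :: "'n \<Rightarrow> real"
  assumes "m > 0" "\<And>i. e i \<ge> 0"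
  defines "A \<equiv> \<lambda>i t. m + t * e i"
  assumes deriv: "\<And>i t. 0 \<le> t \<Longrightarrow> t \<le> 1 \<Longrightarrow> (D i has_real_derivative D' i t) (at t)"
    and ode: "\<And>i t. 0 < t \<Longrightarrow> t < 1 \<Longrightarrow> t * D' i t =
      - (m / (2 * A i t)) * (\<Sum>k\<in>UNIV. A k t * (D i t - D k t) / (A i t + A k t))
      - 5 / 2 * (t * e i) / A i t * D i t"
    and init: "\<And>i. D i 0 = 0"
  shows "D i 1 = 0"
proof -
  define E where "E t = (\<Sum>i\<in>UNIV. (A i t)\<^sup>2 * (D i t)\<^sup>2)" for t
  define E' where "E' t = (\<Sum>i\<in>UNIV. 2 * A i t * e i * (D i t)\<^sup>2 + 2 * (A i t)\<^sup>2 * D i t * D' i t)" for t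
  have A_pos: "A i t > 0" if "t \<ge> 0" for i t
    unfolding A_def using assms(1,2) that by (intro add_pos_nonneg mult_nonneg_nonneg)
  have dE: "(E has_real_derivative E' t) (at t)" if "0 \<le> t" "t \<le> 1" for t
  proof -
    have "((\<lambda>t. (A i t)\<^sup>2 * (D i t)\<^sup>2) has_real_derivative
        2 * A i t * e i * (D i t)\<^sup>2 + 2 * (A i t)\<^sup>2 * D i t * D' i t) (at t)" for i
      unfolding A_def using deriv[OF that, of i]
      by (auto intro!: derivative_eq_intros simp: algebra_simps power2_eq_square)
    then show ?thesis
      unfolding E_def[abs_def] E'_def by (intro DERIV_sum)
  qed
  \<comment> \<open>The system is given only for 0 < t < 1 and multiplied by t, so the sign of
    \<open>t * E' t\<close> is determined there; the end points enter through continuity of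
    \<open>E\<close>.\<close>
  have "E' t \<le> 0" if t: "0 < t" "t < 1" for t
  proof -
    define c where "c i k = A i t * A k t / (A i t + A k t)" for i k
    define L where "L = (\<Sum>i\<in>UNIV. \<Sum>k\<in>UNIV. c i k * (D i t * (D i t - D k t)))"
    have pos: "A i t > 0" for i
      using A_pos t by simp
    have c: "c i k \<ge> 0" "c i k = c k i" for i k
      using pos[of i] pos[of k] by (auto simp: c_def add.commute mult.commute)
    \<comment> \<open>The weights \<open>c i k\<close> are symmetric. Adding the form with exchanged
      indices turns it into a sum of squares of differences.\<close>
    have "L = (\<Sum>i\<in>UNIV. \<Sum>k\<in>UNIV. c i k * (D k t * (D k t - D i t)))"
      unfolding L_def by (subst sum.swap) (use c(2) in \<open>simp add: mult.commute\<close>)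
    then have "2 * L = (\<Sum>i\<in>UNIV. \<Sum>k\<in>UNIV. c i k * (D i t * (D i t - D k t)) + c i k * (D k t * (D k t - D i t)))"
      by (simp add: L_def sum.distrib)
    also have "\<dots> = (\<Sum>i\<in>UNIV. \<Sum>k\<in>UNIV. c i k * (D i t - D k t)\<^sup>2)"
      by (intro sum.cong refl) (simp add: power2_eq_square algebra_simps)
    also have "\<dots> \<ge> 0"
      by (intro sum_nonneg mult_nonneg_nonneg c) auto
    finally have L: "L \<ge> 0"
      by simp
    \<comment> \<open>Differentiating the factor A^2 contributes 2 and the damping term of the
      system -5, leaving -3; with \<open>e i\<close> nonnegative this has the right sign.\<close>
    have step: "t * (2 * A i t * e i * (D i t)\<^sup>2 + 2 * (A i t)\<^sup>2 * D i t * D' i t) =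
        - 3 * (t * A i t * e i * (D i t)\<^sup>2) - m * (\<Sum>k\<in>UNIV. c i k * (D i t * (D i t - D k t)))" for i
    proof -
      have "t * (2 * A i t * e i * (D i t)\<^sup>2 + 2 * (A i t)\<^sup>2 * D i t * D' i t) =
          2 * (t * A i t * e i * (D i t)\<^sup>2) + 2 * (A i t)\<^sup>2 * D i t * (t * D' i t)"
        by (simp add: algebra_simps)
      also have "\<dots> = - 3 * (t * A i t * e i * (D i t)\<^sup>2) -
          m * (A i t * D i t * (\<Sum>k\<in>UNIV. A k t * (D i t - D k t) / (A i t + A k t)))"
      proof -
        have "2 * p + 2 * A\<^sup>2 * v * (- (m / (2 * A)) * S - 5 / 2 * (t * e i) / A * v) =
            2 * p - 5 * (t * A * e i * v\<^sup>2) - m * (A * v * S)" if "A > 0" for p A v S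
          using that by (simp add: power2_eq_square field_simps)
        from this[OF pos[of i]] show ?thesis
          unfolding ode[OF t] by simp
      qed
      also have "A i t * D i t * (\<Sum>k\<in>UNIV. A k t * (D i t - D k t) / (A i t + A k t)) =
          (\<Sum>k\<in>UNIV. c i k * (D i t * (D i t - D k t)))"
        by (simp add: sum_distrib_left c_def mult_ac)
      finally show ?thesis .
    qed
    have "t * E' t = - 3 * (\<Sum>i\<in>UNIV. t * A i t * e i * (D i t)\<^sup>2) - m * L"
      unfolding E'_def L_def sum_distrib_left[of t] step by (simp add: sum_subtractf sum_distrib_left)
    also have "\<dots> \<le> 0"
    proof -
      have "(\<Sum>i\<in>UNIV. t * A i t * e i * (D i t)\<^sup>2) \<ge> 0"
        using t assms(2) pos by (intro sum_nonneg mult_nonneg_nonneg) (auto simp: less_imp_le)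
      moreover have "m * L \<ge> 0"
        using \<open>m > 0\<close> L by simp
      ultimately show ?thesis
        by linarith
    qed
    finally show ?thesis
      using t by (simp add: mult_le_0_iff)
  qed
  then have "\<exists>y. (E has_real_derivative y) (at t) \<and> y \<le> 0" if "0 < t" "t < 1" for t
    using dE[of t] that by auto
  moreover have "continuous_on {0..1} E"
    by (rule DERIV_atLeastAtMost_imp_continuous_on) (use dE in auto)
  ultimately have "E 1 \<le> E 0"
    by (intro DERIV_nonpos_imp_decreasing_open[of 0 1]) auto
  also have "E 0 = 0"
    by (simp add: E_def init)
  finally have "(A i 1)\<^sup>2 * (D i 1)\<^sup>2 = 0"
    using sum_nonneg_eq_0_iff[of UNIV "\<lambda>i. (A i 1)\<^sup>2 * (D i 1)\<^sup>2"]
      sum_nonneg[of UNIV "\<lambda>i. (A i 1)\<^sup>2 * (D i 1)\<^sup>2"]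
    by (auto simp: E_def)
  then show ?thesis
    using A_pos[of 1 i] by simp
qed

section \<open>The period with all exponents 1/4, its gradient and its Hessian\<close>

definition km_period :: "(4 \<Rightarrow> real) \<Rightarrow> real" where
  "km_period = euler_integral (1/4) (3/4) (\<lambda>_. 1/4)"

text \<open>Normalised without the factors from the exponents: \<open>\<partial>\<^sub>i km_period = - km_grad i / 4\<close>.\<close>
definition km_grad :: "4 \<Rightarrow> (4 \<Rightarrow> real) \<Rightarrow> real" where
  "km_grad i = euler_integral (5/4) (3/4) ((\<lambda>_. 1/4)(i := 5/4))"

text \<open>The nested update gives exponent 9/4 when the indices agree. The derivative of
  \<open>km_grad i\<close> in x_k is \<open>- km_hess i k\<close> times 1/4 off the diagonal and 5/4
  on it, hence the recurring shape of a quarter of a row sum plus a diagonal term.\<close>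

definition km_hess :: "4 \<Rightarrow> 4 \<Rightarrow> (4 \<Rightarrow> real) \<Rightarrow> real" where
  "km_hess i k = (let \<beta> = (\<lambda>_. 1/4)(i := 5/4) in euler_integral (9/4) (3/4) (\<beta>(k := \<beta> k + 1)))"

lemma km_period_homogeneity:
  assumes "\<And>k. x k > 0"
  shows "(\<Sum>k\<in>UNIV. x k * km_grad k x) = km_period x"
  using euler_integral_homogeneity[of "1/4" "3/4" x "\<lambda>_. 1/4"] assms
  by (simp add: km_grad_def km_period_def flip: sum_divide_distrib)

lemma sum_quarter_upd:
  fixes g :: "4 \<Rightarrow> real"
  shows "(\<Sum>k\<in>UNIV. ((\<lambda>_. 1/4)(i := 5/4)) k * g k) = (\<Sum>k\<in>UNIV. g k) / 4 + g i"
proof -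
  have "(\<Sum>k\<in>UNIV. ((\<lambda>_. 1/4)(i := 5/4)) k * g k) =
      (\<Sum>k\<in>UNIV. g k / 4 + (if k = i then g k else 0))"
    by (intro sum.cong) auto
  then show ?thesis
    by (simp add: sum.distrib sum_divide_distrib)
qed

text \<open>Euler's identity again, now for degree -5/4: the raised exponents sum to 2 = 5/4 +
  3/4.\<close>

lemma km_grad_homogeneity:
  assumes "\<And>k. x k > 0"
  shows "(\<Sum>k\<in>UNIV. x k * km_hess i k x) / 4 + x i * km_hess i i x = 5/4 * km_grad i x"
proof -
  let ?\<beta> = "(\<lambda>_. 1/4)(i := 5/4) :: 4 \<Rightarrow> real"
  note split = sum_quarter_upd[of i]
  have sum: "(\<Sum>k\<in>UNIV. ?\<beta> k) = 5/4 + 3/4"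
    using split[of "\<lambda>_. 1"] by simp
  have "5/4 * km_grad i x = (\<Sum>k\<in>UNIV. ?\<beta> k * x k *
      euler_integral (5/4 + 1) (3/4) (?\<beta>(k := ?\<beta> k + 1)) x)"
    unfolding km_grad_def
    by (rule euler_integral_homogeneity[of "5/4" "3/4" x, OF _ _ assms sum, symmetric]) auto
  also have "\<dots> = (\<Sum>k\<in>UNIV. ?\<beta> k * (x k * km_hess i k x))"
    by (simp add: km_hess_def Let_def mult.assoc)
  finally show ?thesis
    by (simp only: split)
qed

lemma km_hess_partial_fraction:
  assumes "\<And>k. x k > 0"
  shows "(x k - x i) * km_hess i k x = km_grad i x - km_grad k x"
  using euler_integral_partial_fraction[of "5/4" "3/4" x k i "\<lambda>_. 1/4"] assms
  by (simp add: km_hess_def km_grad_def)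

lemma km_grad_has_real_derivative_curve:
  fixes x x' :: "4 \<Rightarrow> real \<Rightarrow> real"
  assumes "open U" "\<theta> \<in> U"
    and "\<And>k \<theta>. \<theta> \<in> U \<Longrightarrow> x k \<theta> > 0"
    and "\<And>k \<theta>. \<theta> \<in> U \<Longrightarrow> (x k has_real_derivative x' k \<theta>) (at \<theta>)"
    and "\<And>k. continuous_on U (x' k)"
  shows "((\<lambda>\<theta>. km_grad i (\<lambda>k. x k \<theta>)) has_real_derivative
    - ((\<Sum>k\<in>UNIV. x' k \<theta> * km_hess i k (\<lambda>k. x k \<theta>)) / 4 +
       x' i \<theta> * km_hess i i (\<lambda>k. x k \<theta>))) (at \<theta>)"
proof -
  let ?\<beta> = "(\<lambda>_. 1/4)(i := 5/4) :: 4 \<Rightarrow> real"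
  note split = sum_quarter_upd[of i]
  have "((\<lambda>\<theta>. km_grad i (\<lambda>k. x k \<theta>)) has_real_derivative
    - (\<Sum>k\<in>UNIV. ?\<beta> k * x' k \<theta> *
        euler_integral (5/4 + 1) (3/4) (?\<beta>(k := ?\<beta> k + 1)) (\<lambda>k. x k \<theta>))) (at \<theta>)"
    unfolding km_grad_def
    by (rule euler_integral_has_real_derivative_curve[OF _ _ assms]) auto
  moreover have "(\<Sum>k\<in>UNIV. ?\<beta> k * x' k \<theta> *
        euler_integral (5/4 + 1) (3/4) (?\<beta>(k := ?\<beta> k + 1)) (\<lambda>k. x k \<theta>)) =
      (\<Sum>k\<in>UNIV. ?\<beta> k * (x' k \<theta> * km_hess i k (\<lambda>k. x k \<theta>)))"
    by (simp add: km_hess_def Let_def mult.assoc)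
  ultimately show ?thesis
    by (simp only: split)
qed

text \<open>This computes the derivative of \<open>km_grad i\<close> in the direction (1, 1, 1, 1),
  up to sign. Writing x_i = x_k - (x_k - x_i) splits it into a part given by homogeneity and a part
  given by the Euler-Darboux equations, so no second derivative remains.\<close>

lemma km_hess_row_sum:
  assumes "\<And>k. x k > 0"
  shows "(\<Sum>k\<in>UNIV. km_hess i k x) / 4 + km_hess i i x =
    (km_grad i x + (\<Sum>k\<in>UNIV. km_grad k x)) / (4 * x i)"
proof -
  have "x i * ((\<Sum>k\<in>UNIV. km_hess i k x) / 4 + km_hess i i x) =
      (\<Sum>k\<in>UNIV. x k * km_hess i k x) / 4 + x i * km_hess i i x -
      (\<Sum>k\<in>UNIV. (x k - x i) * km_hess i k x) / 4"
    by (simp add: sum_distrib_left sum_subtractf algebra_simps diff_divide_distrib)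
  also have "\<dots> = 5/4 * km_grad i x - (4 * km_grad i x - (\<Sum>k\<in>UNIV. km_grad k x)) / 4"
    unfolding km_grad_homogeneity[of x, OF assms] km_hess_partial_fraction[of x, OF assms] by (simp add: sum_subtractf)
  finally show ?thesis
    using assms[of i] by (simp add: field_simps)
qed

section \<open>The squared mean step and the gradient pulled back by it\<close>

definition quad :: "real \<Rightarrow> real \<Rightarrow> real \<Rightarrow> real \<Rightarrow> 4 \<Rightarrow> real" where
  "quad a b c d k = (if k = 1 then a else if k = 2 then b else if k = 3 then c else d)"

lemma quad_simps [simp]: "quad a b c d 1 = a" "quad a b c d 2 = b" "quad a b c d 3 = c" "quad a b c d 4 = d"
  by (simp_all add: quad_def)

lemma quad_eta: "(\<lambda>k. f (quad a b c d k)) = quad (f a) (f b) (f c) (f d)"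
  by (simp add: fun_eq_iff forall_4)

text \<open>Squaring the entries of the mean step removes the roots: a polynomial map in the
  unsquared variables, homogeneous of degree 2.\<close>

definition km_squares :: "(4 \<Rightarrow> real) \<Rightarrow> 4 \<Rightarrow> real" where
  "km_squares A = quad ((A 1 + A 2 + A 3 + A 4)\<^sup>2 / 16) ((A 1 + A 4) * (A 2 + A 3) / 4)
     ((A 1 + A 3) * (A 2 + A 4) / 4) ((A 1 + A 2) * (A 3 + A 4) / 4)"

lemma km_squares_pos: "(\<And>k. A k > 0) \<Longrightarrow> km_squares A k > 0"
proof -
  assume pos: "\<And>k. A k > 0"
  then have "A 1 + A 2 + A 3 + A 4 > 0"
    by (intro add_pos_pos)
  then show ?thesis
    using exhaust_4[of k] pos by (auto simp: km_squares_def intro!: mult_pos_pos add_pos_pos)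
qed

text \<open>The chain rule for differentiation in a^2, that is 1/(2 a) times the derivative in a,
  where \<open>w\<close> is the gradient at the image point.\<close>

definition km_pullback :: "real \<Rightarrow> real \<Rightarrow> real \<Rightarrow> real \<Rightarrow> (4 \<Rightarrow> real) \<Rightarrow> real" where
  "km_pullback a b c d w = ((a + b + c + d) / 2 * w 1 + (b + c) * w 2 + (b + d) * w 3 + (c + d) * w 4) / (8 * a)"

text \<open>The transposed Jacobian of \<open>km_squares\<close> with row \<open>i\<close> divided by \<open>2 A\<^sub>i\<close>.
  The Klein four-group fixes \<open>km_squares\<close>, so its rows are the first one with permuted arguments.\<close>
definition km_pullback_all :: "(4 \<Rightarrow> real) \<Rightarrow> (4 \<Rightarrow> real) \<Rightarrow> 4 \<Rightarrow> real" where
  "km_pullback_all A w = quad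
     (km_pullback (A 1) (A 2) (A 3) (A 4) w) (km_pullback (A 2) (A 1) (A 4) (A 3) w)
     (km_pullback (A 3) (A 4) (A 1) (A 2) w) (km_pullback (A 4) (A 3) (A 2) (A 1) w)"

text \<open>The algebraic core, a polynomial identity once denominators are cleared. It rewrites
  what the Euler-Darboux equations yield at the image point as a graph Laplacian of the pulled-back
  rows; \<open>N\<close> is the numerator of \<open>km_pullback\<close>.\<close>

lemma km_pullback_identity:
  fixes a b c d w1 w2 w3 w4 :: real
  assumes "a > 0" "b > 0" "c > 0" "d > 0"
  defines "N \<equiv> \<lambda>a b c d w2 w3 w4. (a + b + c + d) / 2 * w1 + (b + c) * w2 + (b + d) * w3 + (c + d) * w4"
  defines "S \<equiv> w1 + w2 + w3 + w4"
  shows "a * (S - w1 - (a + b + c + d) / 2 * ((w2 + S) / (a + d) + (w3 + S) / (a + c) + (w4 + S) / (a + b))) =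
    ((b * N a b c d w2 w3 w4 - a * N b a d c w2 w3 w4) / (a + b) +
     (c * N a b c d w2 w3 w4 - a * N c d a b w2 w3 w4) / (a + c) +
     (d * N a b c d w2 w3 w4 - a * N d c b a w2 w3 w4) / (a + d)) / 2 - 3/2 * N a b c d w2 w3 w4"
proof -
  have pos: "a + b > 0" "a + c > 0" "a + d > 0"
    using assms by auto
  then show ?thesis
    unfolding N_def S_def
    by (simp add: divide_simps) algebra
qed

text \<open>The direction combines the radial field with a translation along (1, 1, 1, 1);
  homogeneity handles the first and the row sum the second.\<close>

lemma km_hess_radial:
  assumes "\<And>k. x k > 0"
  shows "(\<Sum>k\<in>UNIV. (\<alpha> * x k - \<delta>) * km_hess i k x) / 4 + (\<alpha> * x i - \<delta>) * km_hess i i x =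
    5/4 * \<alpha> * km_grad i x - \<delta> * (km_grad i x + (\<Sum>k\<in>UNIV. km_grad k x)) / (4 * x i)"
proof -
  have "(\<Sum>k\<in>UNIV. (\<alpha> * x k - \<delta>) * km_hess i k x) / 4 + (\<alpha> * x i - \<delta>) * km_hess i i x =
      \<alpha> * ((\<Sum>k\<in>UNIV. x k * km_hess i k x) / 4 + x i * km_hess i i x) -
      \<delta> * ((\<Sum>k\<in>UNIV. km_hess i k x) / 4 + km_hess i i x)"
    by (simp add: sum_distrib_left sum_subtractf algebra_simps diff_divide_distrib)
  also have "\<dots> = \<alpha> * (5/4 * km_grad i x) - \<delta> * ((km_grad i x + (\<Sum>k\<in>UNIV. km_grad k x)) / (4 * x i))"
    by (simp only: km_grad_homogeneity[of x, OF assms] km_hess_row_sum[of x, OF assms])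
  finally show ?thesis
    by simp
qed

text \<open>On the line A_k = m + t e_k, the direction 2 A_k (A_k - m) is t times the velocity of
  A_k^2. It splits into a multiple of x_k, handled by homogeneity, and a multiple of x_k - x_i,
  handled by Euler-Darboux.\<close>

lemma km_hess_square_direction:
  assumes "\<And>k. A k > 0"
  defines "x \<equiv> \<lambda>k. (A k)\<^sup>2"
  shows "(\<Sum>k\<in>UNIV. 2 * A k * (A k - m) * km_hess i k x) / 4 + 2 * A i * (A i - m) * km_hess i i x =
    m / (2 * A i) * (\<Sum>k\<in>UNIV. A k * (km_grad i x - km_grad k x) / (A i + A k)) +
    5/2 * (A i - m) / A i * km_grad i x"
proof -
  have xpos: "x k > 0" for k
    using assms(1)[of k] by (simp add: x_def)
  let ?r = "2 * (A i - m) / A i"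
  have "2 * A k * (A k - m) * km_hess i k x = ?r * (x k * km_hess i k x) +
      2 * m / A i * (A k * (km_grad i x - km_grad k x) / (A i + A k))" for k
  proof -
    have "2 * A k * (A k - m) = ?r * x k + 2 * m / A i * (A k * (x k - x i) / (A i + A k))"
    proof -
      have eq: "A k * (x k - x i) / (A i + A k) = A k * (A k - A i)"
        using assms(1)[of i] assms(1)[of k] by (simp add: x_def power2_eq_square field_simps)
      show ?thesis
        unfolding eq using assms(1)[of i] by (simp add: x_def power2_eq_square field_simps)
    qed
    moreover have "(r * y + s * (z * u / v)) * h = r * (y * h) + s * (z * (u * h) / v)" for r y s z u v h :: real
      by (simp add: algebra_simps)
    ultimately have "2 * A k * (A k - m) * km_hess i k x = ?r * (x k * km_hess i k x) +
        2 * m / A i * (A k * ((x k - x i) * km_hess i k x) / (A i + A k))"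
      by (simp only:)
    then show ?thesis
      by (simp only: km_hess_partial_fraction[of x, OF xpos])
  qed
  then have "(\<Sum>k\<in>UNIV. 2 * A k * (A k - m) * km_hess i k x) =
      ?r * (\<Sum>k\<in>UNIV. x k * km_hess i k x) +
      2 * m / A i * (\<Sum>k\<in>UNIV. A k * (km_grad i x - km_grad k x) / (A i + A k))"
    by (simp add: sum.distrib sum_distrib_left)
  moreover have "2 * A i * (A i - m) = ?r * x i"
    using assms(1)[of i] by (simp add: x_def power2_eq_square)
  ultimately have "(\<Sum>k\<in>UNIV. 2 * A k * (A k - m) * km_hess i k x) / 4 + 2 * A i * (A i - m) * km_hess i i x =
      ?r * ((\<Sum>k\<in>UNIV. x k * km_hess i k x) / 4 + x i * km_hess i i x) +
      m / (2 * A i) * (\<Sum>k\<in>UNIV. A k * (km_grad i x - km_grad k x) / (A i + A k))"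
    by (simp add: add_divide_distrib algebra_simps)
  also have "\<dots> = ?r * (5/4 * km_grad i x) +
      m / (2 * A i) * (\<Sum>k\<in>UNIV. A k * (km_grad i x - km_grad k x) / (A i + A k))"
    by (simp only: km_grad_homogeneity[of x, OF xpos])
  also have "?r * (5/4 * km_grad i x) = 5/2 * (A i - m) / A i * km_grad i x"
    using assms(1)[of i] by (simp add: field_simps)
  finally show ?thesis
    by (simp only: add.commute)
qed

text \<open>The derivative along a curve with velocities \<open>ea\<close>, \<open>eb\<close>,
  \<open>ec\<close>, \<open>ed\<close> and \<open>w'\<close>; the last summand comes from the
  prefactor 1/(8 a).\<close>

definition km_pullback' where
  "km_pullback' a b c d ea eb ec ed w w' =
    ((ea + eb + ec + ed) / 2 * w 1 + (a + b + c + d) / 2 * w' 1 + (eb + ec) * w 2 + (b + c) * w' 2 +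
     (eb + ed) * w 3 + (b + d) * w' 3 + (ec + ed) * w 4 + (c + d) * w' 4) / (8 * a) -
    ea / a * km_pullback a b c d w" for w w' :: "4 \<Rightarrow> real"

lemma km_pullback_has_real_derivative:
  assumes "(a has_real_derivative ea) (at t)" "(b has_real_derivative eb) (at t)"
    "(c has_real_derivative ec) (at t)" "(d has_real_derivative ed) (at t)"
    "\<And>k. (w k has_real_derivative w' k) (at t)" "a t > 0"
  shows "((\<lambda>t. km_pullback (a t) (b t) (c t) (d t) (\<lambda>k. w k t)) has_real_derivative
    km_pullback' (a t) (b t) (c t) (d t) ea eb ec ed (\<lambda>k. w k t) w') (at t)"
  unfolding km_pullback_def km_pullback'_def using assms(6)
  by (auto intro!: derivative_eq_intros assms(1-5) simp: field_simps power2_eq_square)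

text \<open>One row of the proof that the pullback solves the same system as the gradient. The
  hypothesis on \<open>w'\<close> is the equation that \<open>km_hess_radial\<close> gives at the
  image point.\<close>

lemma km_pullback_radial:
  fixes w w' :: "4 \<Rightarrow> real"
  assumes pos: "a > 0" "b > 0" "c > 0" "d > 0"
    and e: "t * ea = a - m" "t * eb = b - m" "t * ec = c - m" "t * ed = d - m"
    and w: "\<And>k. t * w' k = m * (a + b + c + d) / 8 *
      ((w k + (\<Sum>k\<in>UNIV. w k)) / km_squares (quad a b c d) k) - 5/2 * w k"
  shows "t * km_pullback' a b c d ea eb ec ed w w' =
    - (m / (2 * a)) *
      (b * (km_pullback a b c d w - km_pullback b a d c w) / (a + b) +
       c * (km_pullback a b c d w - km_pullback c d a b w) / (a + c) +
       d * (km_pullback a b c d w - km_pullback d c b a w) / (a + d)) -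
    5/2 * (a - m) / a * km_pullback a b c d w"
proof -
  define S where "S = (\<Sum>k\<in>UNIV. w k)"
  have S: "S = w 1 + w 2 + w 3 + w 4"
    by (simp add: S_def sum_4)
  define \<sigma> where "\<sigma> = a + b + c + d"
  define N where "N a b c d = (a + b + c + d) / 2 * w 1 + (b + c) * w 2 + (b + d) * w 3 + (c + d) * w 4"
    for a b c d
  have pb: "km_pullback a b c d w = N a b c d / (8 * a)" for a b c d
    by (simp add: km_pullback_def N_def)
  define R where "R = (b * N a b c d - a * N b a d c) / (a + b) +
     (c * N a b c d - a * N c d a b) / (a + c) + (d * N a b c d - a * N d c b a) / (a + d)"
  have \<sigma>: "\<sigma> > 0"
    using pos by (simp add: \<sigma>_def)
  have id: "S - w 1 - \<sigma> / 2 * ((w 2 + S) / (a + d) + (w 3 + S) / (a + c) + (w 4 + S) / (a + b)) =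
      (R / 2 - 3/2 * N a b c d) / a"
  proof -
    have "a * (S - w 1 - \<sigma> / 2 * ((w 2 + S) / (a + d) + (w 3 + S) / (a + c) + (w 4 + S) / (a + b))) =
        R / 2 - 3/2 * N a b c d"
      unfolding R_def N_def S \<sigma>_def by (rule km_pullback_identity[OF pos])
    then show ?thesis
      using \<open>a > 0\<close> by (simp only: eq_divide_eq mult.commute) simp
  qed
  have w1: "\<sigma> / 2 * (t * w' 1) = m * (w 1 + S) - 5/2 * (\<sigma> / 2 * w 1)"
  proof -
    have sq: "km_squares (quad a b c d) 1 = \<sigma>\<^sup>2 / 16"
      by (simp add: km_squares_def \<sigma>_def)
    then show ?thesis
      unfolding w S_def[symmetric] \<sigma>_def[symmetric] sq using \<sigma>
      by (simp add: power2_eq_square field_simps)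
  qed
  \<comment> \<open>Entries 2 to 4 of \<open>km_squares\<close> are products q p / 4, where p is the
    coefficient of that entry in the pullback. Cancelling p leaves the single denominator q.\<close>
  have factor: "p * (m * \<sigma> / 8 * (y / (q * p / 4)) - 5/2 * z) = m * (\<sigma> / 2) * (y / q) - 5/2 * (p * z)"
    if "p > 0" "q > 0" for p q y z
    using that by (simp add: field_simps)
  have w2: "(b + c) * (t * w' 2) = m * (\<sigma> / 2) * ((w 2 + S) / (a + d)) - 5/2 * ((b + c) * w 2)"
    unfolding w S_def[symmetric] km_squares_def quad_simps \<sigma>_def[symmetric]
    by (rule factor) (use pos in auto)
  have w3: "(b + d) * (t * w' 3) = m * (\<sigma> / 2) * ((w 3 + S) / (a + c)) - 5/2 * ((b + d) * w 3)"
    unfolding w S_def[symmetric] km_squares_def quad_simps \<sigma>_def[symmetric]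
    by (rule factor) (use pos in auto)
  have w4: "(c + d) * (t * w' 4) = m * (\<sigma> / 2) * ((w 4 + S) / (a + b)) - 5/2 * ((c + d) * w 4)"
    unfolding w S_def[symmetric] km_squares_def quad_simps \<sigma>_def[symmetric]
    by (rule factor) (use pos in auto)
  have "8 * a * (t * km_pullback' a b c d ea eb ec ed w w') =
      (t * ea + t * eb + t * ec + t * ed) / 2 * w 1 + \<sigma> / 2 * (t * w' 1) +
      (t * eb + t * ec) * w 2 + (b + c) * (t * w' 2) + (t * eb + t * ed) * w 3 + (b + d) * (t * w' 3) +
      (t * ec + t * ed) * w 4 + (c + d) * (t * w' 4) - t * ea / a * N a b c d"
    unfolding km_pullback'_def pb \<sigma>_def using pos by (simp add: field_simps)
  \<comment> \<open>The velocities turn the coefficients into N - 2 m S; together with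
    \<open>m * (w 1 + S)\<close> from \<open>w1\<close> this produces the left side of
    \<open>id\<close>.\<close>
  also have "\<dots> = N a b c d - 5/2 * N a b c d - (a - m) / a * N a b c d -
      m * (S - w 1 - \<sigma> / 2 * ((w 2 + S) / (a + d) + (w 3 + S) / (a + c) + (w 4 + S) / (a + b)))"
    unfolding e w1 w2 w3 w4 unfolding N_def S \<sigma>_def
    by (simp add: algebra_simps add_divide_distrib diff_divide_distrib)
  \<comment> \<open>The coefficients of N add up: 1 - 5/2 + 3 m/(2 a) - (a - m)/a = -(5/2) (a -
    m)/a.\<close>
  also have "\<dots> = - (m / (2 * a)) * R - 5/2 * (a - m) / a * N a b c d"
    unfolding id using pos by (simp add: field_simps)
  also have "\<dots> = 8 * a * (- (m / (2 * a)) *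
      (b * (km_pullback a b c d w - km_pullback b a d c w) / (a + b) +
       c * (km_pullback a b c d w - km_pullback c d a b w) / (a + c) +
       d * (km_pullback a b c d w - km_pullback d c b a w) / (a + d)) -
    5/2 * (a - m) / a * km_pullback a b c d w)"
  proof -
    have row: "y * (N1 / (8 * a) - N2 / (8 * y)) / z = (y * N1 - a * N2) / z / (8 * a)"
      if "y > 0" "z > 0" for y z N1 N2
      using that pos by (simp add: field_simps)
    have R: "b * (km_pullback a b c d w - km_pullback b a d c w) / (a + b) +
       c * (km_pullback a b c d w - km_pullback c d a b w) / (a + c) +
       d * (km_pullback a b c d w - km_pullback d c b a w) / (a + d) = R / (8 * a)"
      unfolding pb R_def add_divide_distrib
      by (intro arg_cong2[where f = "(+)"] row) (use pos in auto)
    show ?thesis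
      unfolding R unfolding pb using pos by (simp add: field_simps)
  qed
  finally show ?thesis
    using pos by simp
qed

section \<open>Invariance of the period under the mean step\<close>

lemma km_grad_const: "c > 0 \<Longrightarrow> km_grad i (\<lambda>_. c) = km_grad j (\<lambda>_. c)"
  \<comment> \<open>At equal variables the Euler-Darboux relation has left side 0.\<close>
  using km_hess_partial_fraction[of "\<lambda>_. c" j i] by simp

text \<open>Along the line to the diagonal both sides solve the system of
  \<open>singular_system_unique\<close> and agree at t = 0; the value at t = 1 is the claim.\<close>

lemma km_grad_pullback:
  fixes A\<^sub>0 :: "4 \<Rightarrow> real"
  assumes "\<And>i. A\<^sub>0 i > 0"
  shows "km_grad i (\<lambda>k. (A\<^sub>0 k)\<^sup>2) = km_pullback_all A\<^sub>0 (\<lambda>k. km_grad k (km_squares A\<^sub>0)) i"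
proof -
  \<comment> \<open>The minimum is chosen so that every \<open>e i\<close> is nonnegative, as the
    energy estimate requires.\<close>
  define m where "m = Min (range A\<^sub>0)"
  define e where "e i = A\<^sub>0 i - m" for i
  define A where "A i t = m + t * e i" for i t
  have "m > 0"
    using assms by (auto simp: m_def)
  have "e i \<ge> 0" for i
    by (simp add: e_def m_def)
  \<comment> \<open>An open set containing [0, 1] is needed because derivatives at the end points
    are two-sided.\<close>
  define U where "U = {t. \<forall>i. A i t > 0}"
  have "U = (\<Inter>i. {t. A i t > 0})"
    by (auto simp: U_def)
  then have "open U"
    unfolding A_def by (auto intro!: open_INT open_Collect_less continuous_intros)
  have in_U: "t \<in> U" if "t \<ge> 0" for t
    unfolding U_def A_def using \<open>m > 0\<close> \<open>\<And>i. e i \<ge> 0\<close> that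
    by (auto intro!: add_pos_nonneg mult_nonneg_nonneg)
  have A_pos: "A i t > 0" if "t \<in> U" for i t
    using that by (simp add: U_def)
  have dA: "(A i has_real_derivative e i) (at t)" for i t
    unfolding A_def by (auto intro!: derivative_eq_intros)
  have te: "t * e i = A i t - m" for i t
    by (simp add: A_def)

  define x x' where "x k t = (A k t)\<^sup>2" and "x' k t = 2 * A k t * e k" for k t
  define p p' where "p i t = km_grad i (\<lambda>k. x k t)" and
    "p' i t = - ((\<Sum>k\<in>UNIV. x' k t * km_hess i k (\<lambda>k. x k t)) / 4 + x' i t * km_hess i i (\<lambda>k. x k t))"
    for i t
  have dp: "(p i has_real_derivative p' i t) (at t)" if "t \<in> U" for i t
    unfolding p_def p'_def
  proof (rule km_grad_has_real_derivative_curve[OF \<open>open U\<close> that])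
    show "(x k has_real_derivative x' k t) (at t)" for k t
      unfolding x_def x'_def by (auto intro!: derivative_eq_intros dA)
    show "continuous_on U (x' k)" for k
      unfolding x'_def A_def by (intro continuous_intros)
  qed (simp add: x_def A_pos less_imp_neq[symmetric])
  have p_ode: "t * p' i t =
      - (m / (2 * A i t)) * (\<Sum>k\<in>UNIV. A k t * (p i t - p k t) / (A i t + A k t))
      - 5 / 2 * (t * e i) / A i t * p i t" if "t \<in> U" for i t
  proof -
    have tx: "t * x' k t = 2 * A k t * (A k t - m)" for k
      unfolding x'_def te[symmetric] by simp
    have "t * p' i t = - ((\<Sum>k\<in>UNIV. t * x' k t * km_hess i k (\<lambda>k. x k t)) / 4 +
        t * x' i t * km_hess i i (\<lambda>k. x k t))"
      by (simp only: p'_def mult_minus_right distrib_left times_divide_eq_right sum_distrib_left mult.assoc)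
    then show ?thesis
      unfolding tx x_def p_def te
      using km_hess_square_direction[of "\<lambda>k. A k t", OF A_pos[OF that], of m i] by simp
  qed

  define y where "y k t = km_squares (\<lambda>i. A i t) k" for k t
  define y' where "y' k t = quad
    ((A 1 t + A 2 t + A 3 t + A 4 t) * (e 1 + e 2 + e 3 + e 4) / 8)
    (((e 1 + e 4) * (A 2 t + A 3 t) + (A 1 t + A 4 t) * (e 2 + e 3)) / 4)
    (((e 1 + e 3) * (A 2 t + A 4 t) + (A 1 t + A 3 t) * (e 2 + e 4)) / 4)
    (((e 1 + e 2) * (A 3 t + A 4 t) + (A 1 t + A 2 t) * (e 3 + e 4)) / 4) k" for k t
  define w w' where "w i t = km_grad i (\<lambda>k. y k t)" and
    "w' i t = - ((\<Sum>k\<in>UNIV. y' k t * km_hess i k (\<lambda>k. y k t)) / 4 + y' i t * km_hess i i (\<lambda>k. y k t))"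
    for i t
  have y_pos: "y k t > 0" if "t \<in> U" for k t
    unfolding y_def by (intro km_squares_pos A_pos that)
  have dw: "(w i has_real_derivative w' i t) (at t)" if "t \<in> U" for i t
    unfolding w_def w'_def
  proof (rule km_grad_has_real_derivative_curve[OF \<open>open U\<close> that])
    have "\<forall>k. (y k has_real_derivative y' k t) (at t)" for t
      unfolding y_def y'_def km_squares_def forall_4
      by (auto intro!: derivative_eq_intros dA simp: algebra_simps add_divide_distrib)
    then show "(y k has_real_derivative y' k t) (at t)" for k t
      by simp
    have "\<forall>k. continuous_on U (y' k)"
      unfolding y'_def A_def forall_4 by (auto intro!: continuous_intros)
    then show "continuous_on U (y' k)" for k
      by simp
  qed (rule y_pos)
  have w_radial: "t * w' i t = m * (A 1 t + A 2 t + A 3 t + A 4 t) / 8 *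
      ((w i t + (\<Sum>k\<in>UNIV. w k t)) / y i t) - 5/2 * w i t" if "t \<in> U" for i t
  proof -
    let ?\<delta> = "m * (A 1 t + A 2 t + A 3 t + A 4 t) / 2"
    \<comment> \<open>The map is homogeneous of degree 2 and t e = A - m, so the radial part gives 2
      y. The derivative along (1, 1, 1, 1) is half the sum of the A_i in every component, and m
      times it is \<open>?\<delta>\<close>.\<close>
    have "\<forall>k. t * y' k t = 2 * y k t - ?\<delta>"
    proof -
      have "t * y' 1 t = (A 1 t + A 2 t + A 3 t + A 4 t) * (t * e 1 + t * e 2 + t * e 3 + t * e 4) / 8"
        by (simp add: y'_def algebra_simps)
      moreover have "t * y' 2 t =
          ((t * e 1 + t * e 4) * (A 2 t + A 3 t) + (A 1 t + A 4 t) * (t * e 2 + t * e 3)) / 4"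
        by (simp add: y'_def algebra_simps)
      moreover have "t * y' 3 t =
          ((t * e 1 + t * e 3) * (A 2 t + A 4 t) + (A 1 t + A 3 t) * (t * e 2 + t * e 4)) / 4"
        by (simp add: y'_def algebra_simps)
      moreover have "t * y' 4 t =
          ((t * e 1 + t * e 2) * (A 3 t + A 4 t) + (A 1 t + A 2 t) * (t * e 3 + t * e 4)) / 4"
        by (simp add: y'_def algebra_simps)
      ultimately show ?thesis
        unfolding te forall_4 by (simp add: y_def km_squares_def power2_eq_square field_simps)
    qed
    then have ty: "t * y' k t = 2 * y k t - ?\<delta>" for k
      by simp
    have "t * w' i t = - ((\<Sum>k\<in>UNIV. t * y' k t * km_hess i k (\<lambda>k. y k t)) / 4 +
        t * y' i t * km_hess i i (\<lambda>k. y k t))"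
      by (simp only: w'_def mult_minus_right distrib_left times_divide_eq_right sum_distrib_left mult.assoc)
    also have "\<dots> = - (5/4 * 2 * w i t - ?\<delta> * (w i t + (\<Sum>k\<in>UNIV. w k t)) / (4 * y i t))"
      unfolding ty w_def using km_hess_radial[of "\<lambda>k. y k t", OF y_pos[OF that], of 2 ?\<delta> i] by simp
    finally show ?thesis
      by simp
  qed

  define q where "q i t = km_pullback_all (\<lambda>i. A i t) (\<lambda>k. w k t) i" for i t
  define q' where "q' i t = quad
    (km_pullback' (A 1 t) (A 2 t) (A 3 t) (A 4 t) (e 1) (e 2) (e 3) (e 4) (\<lambda>k. w k t) (\<lambda>k. w' k t))
    (km_pullback' (A 2 t) (A 1 t) (A 4 t) (A 3 t) (e 2) (e 1) (e 4) (e 3) (\<lambda>k. w k t) (\<lambda>k. w' k t))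
    (km_pullback' (A 3 t) (A 4 t) (A 1 t) (A 2 t) (e 3) (e 4) (e 1) (e 2) (\<lambda>k. w k t) (\<lambda>k. w' k t))
    (km_pullback' (A 4 t) (A 3 t) (A 2 t) (A 1 t) (e 4) (e 3) (e 2) (e 1) (\<lambda>k. w k t) (\<lambda>k. w' k t)) i" for i t
  have dq: "(q i has_real_derivative q' i t) (at t)" if "t \<in> U" for i t
  proof -
    have "\<forall>i. (q i has_real_derivative q' i t) (at t)"
      unfolding forall_4 q_def q'_def km_pullback_all_def quad_simps
      by (intro conjI km_pullback_has_real_derivative dA dw A_pos that)
    then show ?thesis
      by simp
  qed
  have q_ode: "t * q' i t =
      - (m / (2 * A i t)) * (\<Sum>k\<in>UNIV. A k t * (q i t - q k t) / (A i t + A k t))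
      - 5 / 2 * (t * e i) / A i t * q i t" if "t \<in> U" for i t
  proof -
    note pos = A_pos[OF that]
    \<comment> \<open>Invariance under the Klein four-group lets the one-row computation serve for
      all four rows.\<close>
    have y: "y k t = km_squares (quad (A 1 t) (A 2 t) (A 3 t) (A 4 t)) k"
      "y k t = km_squares (quad (A 2 t) (A 1 t) (A 4 t) (A 3 t)) k"
      "y k t = km_squares (quad (A 3 t) (A 4 t) (A 1 t) (A 2 t)) k"
      "y k t = km_squares (quad (A 4 t) (A 3 t) (A 2 t) (A 1 t)) k" for k
      by (simp_all add: y_def km_squares_def add_ac mult_ac)
    note rows = km_pullback_radial[OF pos[of 1] pos[of 2] pos[of 3] pos[of 4] te te te te,
        of "\<lambda>k. w' k t" "\<lambda>k. w k t", folded y]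
      km_pullback_radial[OF pos[of 2] pos[of 1] pos[of 4] pos[of 3] te te te te,
        of "\<lambda>k. w' k t" "\<lambda>k. w k t", folded y]
      km_pullback_radial[OF pos[of 3] pos[of 4] pos[of 1] pos[of 2] te te te te,
        of "\<lambda>k. w' k t" "\<lambda>k. w k t", folded y]
      km_pullback_radial[OF pos[of 4] pos[of 3] pos[of 2] pos[of 1] te te te te,
        of "\<lambda>k. w' k t" "\<lambda>k. w k t", folded y]
    have "\<forall>i. t * q' i t =
      - (m / (2 * A i t)) * (\<Sum>k\<in>UNIV. A k t * (q i t - q k t) / (A i t + A k t))
      - 5 / 2 * (t * e i) / A i t * q i t"
      unfolding forall_4 q_def q'_def km_pullback_all_def quad_simps sum_4 te
      by (subst rows(1), use w_radial[OF that] in \<open>simp add: add_ac\<close>,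
          subst rows(2), use w_radial[OF that] in \<open>simp add: add_ac\<close>,
          subst rows(3), use w_radial[OF that] in \<open>simp add: add_ac\<close>,
          subst rows(4), use w_radial[OF that] in \<open>simp add: add_ac\<close>,
          simp add: add_ac)
    then show ?thesis
      by simp
  qed

  \<comment> \<open>On the diagonal all gradient components coincide, and the coefficients of each
    pullback row sum to 8 m / (8 m) = 1.\<close>
  have "p i 0 - q i 0 = 0" for i
  proof -
    have A0: "A i 0 = m" for i
      by (simp add: A_def)
    have "\<forall>k. km_squares (\<lambda>i. m) k = m\<^sup>2"
      by (simp add: forall_4 km_squares_def power2_eq_square)
    then have "w k 0 = km_grad i (\<lambda>_. m\<^sup>2)" for k
      using km_grad_const[of "m\<^sup>2" k i] \<open>m > 0\<close> by (simp add: w_def y_def A0)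
    moreover have "p i 0 = km_grad i (\<lambda>_. m\<^sup>2)"
      by (simp add: p_def x_def A0)
    moreover have "\<forall>i. km_pullback_all (\<lambda>_. m) (\<lambda>_. g) i = g" for g
      using \<open>m > 0\<close> by (simp add: forall_4 km_pullback_all_def km_pullback_def field_simps)
    ultimately show ?thesis
      by (simp add: q_def A0)
  qed
  \<comment> \<open>The system is linear, so the difference of two solutions satisfies it.\<close>
  moreover have "t * (p' i t - q' i t) =
      - (m / (2 * (m + t * e i))) * (\<Sum>k\<in>UNIV. (m + t * e k) * ((p i t - q i t) - (p k t - q k t)) /
        ((m + t * e i) + (m + t * e k)))
      - 5 / 2 * (t * e i) / (m + t * e i) * (p i t - q i t)" if "0 < t" "t < 1" for i t
  proof -
    have "(\<Sum>k\<in>UNIV. A k t * ((p i t - q i t) - (p k t - q k t)) / (A i t + A k t)) =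
        (\<Sum>k\<in>UNIV. A k t * (p i t - p k t) / (A i t + A k t)) -
        (\<Sum>k\<in>UNIV. A k t * (q i t - q k t) / (A i t + A k t))"
      unfolding sum_subtractf[symmetric] diff_divide_distrib[symmetric]
      by (intro sum.cong refl) (simp add: algebra_simps)
    then show ?thesis
      using p_ode[of t i] q_ode[of t i] in_U[of t] that unfolding A_def
      by (simp only: right_diff_distrib)
  qed
  ultimately have "p i 1 - q i 1 = 0"
    using in_U \<open>m > 0\<close> \<open>\<And>i. e i \<ge> 0\<close>
    by (intro singular_system_unique[where D = "\<lambda>i t. p i t - q i t" and D' = "\<lambda>i t. p' i t - q' i t"])
      (auto intro!: DERIV_diff dp dq)
  moreover have "A i 1 = A\<^sub>0 i" for i
    by (simp add: A_def e_def)
  ultimately show ?thesis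
    by (simp add: p_def q_def w_def x_def y_def)
qed

text \<open>Euler's identity recovers the period from its gradient on both sides, so no integration
  along a path is needed. The middle equality is Euler's identity for \<open>km_squares\<close>, of
  degree 2.\<close>

theorem km_period_invariant:
  assumes "\<And>i. A i > 0"
  shows "km_period (km_squares A) = km_period (\<lambda>k. (A k)\<^sup>2)"
proof -
  have "km_period (\<lambda>k. (A k)\<^sup>2) = (\<Sum>i\<in>UNIV. (A i)\<^sup>2 * km_grad i (\<lambda>k. (A k)\<^sup>2))"
    by (intro km_period_homogeneity[symmetric] zero_less_power assms)
  also have "\<dots> = (\<Sum>i\<in>UNIV. (A i)\<^sup>2 * km_pullback_all A (\<lambda>k. km_grad k (km_squares A)) i)"
    by (simp only: km_grad_pullback[of A, OF assms])
  also have "\<dots> = (\<Sum>k\<in>UNIV. km_squares A k * km_grad k (km_squares A))"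
  proof -
    have row: "a\<^sup>2 * km_pullback a b c d w = a * ((a + b + c + d) / 2 * w 1 + (b + c) * w 2 + (b + d) * w 3 + (c + d) * w 4) / 8"
      if "a > 0" for a b c d and w :: "4 \<Rightarrow> real"
      using that by (simp add: km_pullback_def power2_eq_square)
    have "(\<Sum>i\<in>UNIV. (A i)\<^sup>2 * km_pullback_all A w i) = (\<Sum>k\<in>UNIV. km_squares A k * w k)" for w
      unfolding sum_4 km_pullback_all_def quad_simps row[OF assms] km_squares_def
      by (simp add: power2_eq_square field_simps)
    then show ?thesis .
  qed
  also have "\<dots> = km_period (km_squares A)"
    using assms by (intro km_period_homogeneity km_squares_pos)
  finally show ?thesis ..
qed

section \<open>Lauricella's series as an Euler integral\<close>

lemma has_sum_product_nonneg:
  fixes f g :: "_ \<Rightarrow> real"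
  assumes f: "(f has_sum a) A" and g: "(g has_sum b) B"
    and "\<And>x. x \<in> A \<Longrightarrow> f x \<ge> 0" "\<And>y. y \<in> B \<Longrightarrow> g y \<ge> 0"
  shows "((\<lambda>(x, y). f x * g y) has_sum a * b) (A \<times> B)"
proof -
  have 1: "((\<lambda>y. f x * g y) has_sum f x * b) B" for x
    by (rule has_sum_cmult_right[OF g])
  have 2: "((\<lambda>x. f x * b) has_sum a * b) A"
    by (rule has_sum_cmult_left[OF f])
  have "(\<lambda>(x, y). f x * g y) summable_on A \<times> B"
    by (rule summable_on_SigmaI[where g = "\<lambda>x. f x * b"])
      (use 1 2 assms in \<open>auto simp: summable_on_def\<close>)
  with 1 2 show ?thesis
    by (intro has_sum_SigmaI) auto
qed

text \<open>Monotone convergence for unordered sums: enumerate \<open>I\<close>, bound the partial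
  sums by \<open>F\<close>, integrate the series termwise, and use nonnegativity to forget the order
  again.\<close>

lemma has_sum_integral_nonneg:
  fixes f :: "'i \<Rightarrow> 'a \<Rightarrow> real"
  assumes I: "countable I" "infinite I"
    and has_sum: "\<And>t. t \<in> space M \<Longrightarrow> ((\<lambda>i. f i t) has_sum F t) I"
    and nonneg: "\<And>i t. i \<in> I \<Longrightarrow> t \<in> space M \<Longrightarrow> f i t \<ge> 0"
    and int_f: "\<And>i. i \<in> I \<Longrightarrow> integrable M (f i)"
    and int_F: "integrable M F"
  shows "((\<lambda>i. integral\<^sup>L M (f i)) has_sum integral\<^sup>L M F) I"
proof -
  define r where "r = from_nat_into I"
  have r: "bij_betw r UNIV I"
    unfolding r_def using I by (rule bij_betw_from_nat_into)
  then have r_in: "r n \<in> I" for n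
    by (auto simp: bij_betw_def)
  have has_sum_r: "((\<lambda>n. f (r n) t) has_sum F t) UNIV" if "t \<in> space M" for t
    using has_sum[OF that] by (subst has_sum_reindex_bij_betw[OF r])
  have sums: "(\<lambda>n. f (r n) t) sums F t" if "t \<in> space M" for t
    using has_sum_r[OF that] by (rule has_sum_imp_sums)
  have "(\<lambda>n. integral\<^sup>L M (f (r n))) sums (\<integral>t. (\<Sum>n. f (r n) t) \<partial>M)"
  proof (rule sums_integral)
    show "integrable M (f (r n))" for n
      by (intro int_f r_in)
    show "AE t in M. summable (\<lambda>n. norm (f (r n) t))"
      using sums nonneg[OF r_in] by (auto simp: sums_iff)
    show "summable (\<lambda>n. \<integral>t. norm (f (r n) t) \<partial>M)"
    proof (rule bounded_imp_summable)
      fix n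
      have "(\<Sum>k\<le>n. \<integral>t. norm (f (r k) t) \<partial>M) = (\<Sum>k\<le>n. \<integral>t. f (r k) t \<partial>M)"
        by (intro sum.cong Bochner_Integration.integral_cong refl) (auto simp: nonneg r_in)
      also have "\<dots> = (\<integral>t. (\<Sum>k\<le>n. f (r k) t) \<partial>M)"
        by (rule Bochner_Integration.integral_sum[symmetric]) (intro int_f r_in)
      also have "\<dots> \<le> integral\<^sup>L M F"
      proof (rule integral_mono)
        show "integrable M (\<lambda>t. \<Sum>k\<le>n. f (r k) t)"
          by (intro Bochner_Integration.integrable_sum int_f r_in)
        show "(\<Sum>k\<le>n. f (r k) t) \<le> F t" if "t \<in> space M" for t
          using sum_le_suminf[of "\<lambda>n. f (r n) t" "{..n}"] sums[OF that] nonneg[OF r_in that]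
          by (auto simp: sums_iff)
      qed (rule int_F)
      finally show "(\<Sum>k\<le>n. \<integral>t. norm (f (r k) t) \<partial>M) \<le> integral\<^sup>L M F" .
    qed simp
  qed
  also have "(\<integral>t. (\<Sum>n. f (r n) t) \<partial>M) = integral\<^sup>L M F"
    by (intro Bochner_Integration.integral_cong refl) (use sums in \<open>auto simp: sums_iff\<close>)
  finally have "((\<lambda>n. integral\<^sup>L M (f (r n))) has_sum integral\<^sup>L M F) UNIV"
    by (rule sums_nonneg_imp_has_sum)
      (intro Bochner_Integration.integral_nonneg_AE AE_I2 nonneg r_in)
  then show ?thesis
    by (subst (asm) has_sum_reindex_bij_betw[OF r])
qed

text \<open>Newton's binomial series; for u in [0, 1) its terms are nonnegative, hence unordered
  summability.\<close>

lemma has_sum_pochhammer_powr: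
  fixes \<beta> u :: real
  assumes "0 \<le> u" "u < 1" "\<beta> > 0"
  shows "((\<lambda>n. pochhammer \<beta> n / fact n * u ^ n) has_sum (1 - u) powr (- \<beta>)) UNIV"
proof -
  have "(\<lambda>n. ((- \<beta>) gchoose n) * (- u) ^ n) sums (1 + (- u)) powr (- \<beta>)"
    using assms by (intro gen_binomial_real) auto
  moreover have "((- \<beta>) gchoose n) * (- u) ^ n = pochhammer \<beta> n / fact n * u ^ n" for n
    by (simp add: gbinomial_pochhammer power_minus[of u n])
  ultimately have "(\<lambda>n. pochhammer \<beta> n / fact n * u ^ n) sums (1 - u) powr (- \<beta>)"
    by simp
  then show ?thesis
    by (rule sums_nonneg_imp_has_sum) (use assms in \<open>auto simp: pochhammer_nonneg\<close>)
qed

lemma beta_weight_add: "beta_weight (a + real n) b t = t ^ n * beta_weight a b t"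
proof (induction n)
  case (Suc n)
  then show ?case
    using beta_weight_Suc[of "a + real n" b t] by (simp add: add_ac mult_ac)
qed simp

text \<open>Source of the quotient of Pochhammer symbols of \<alpha> and \<gamma> in Lauricella's
  coefficients.\<close>

lemma Beta_add_nat:
  fixes a b :: real
  assumes "a > 0" "b > 0"
  shows "Beta (a + real n) b = Beta a b * pochhammer a n / pochhammer (a + b) n"
proof (induction n)
  case (Suc n)
  have "a + real n \<notin> \<int>\<^sub>\<le>\<^sub>0"
    using assms by (auto elim!: nonpos_Ints_cases)
  from Beta_plus1_left[OF this, of b]
  have "Beta (a + real n + 1) b = (a + real n) / (a + real n + b) * Beta (a + real n) b"
    using assms by (simp add: field_simps)
  then show ?case
    using Suc by (simp add: pochhammer_Suc add_ac mult_ac)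
qed simp

lemma prod_4: "prod f (UNIV :: 4 set) = f 1 * f 2 * f 3 * f 4"
  unfolding UNIV_4 by (simp add: ac_simps)

text \<open>Three kernel factors are expanded by the binomial series and integrated termwise. The
  first variable is 1, with kernel factor 1, so \<open>\<beta>\<^sub>0\<close> may later be set to
  1/4 to obtain the symmetric period.\<close>

theorem lauricella_FD_euler_integral:
  fixes \<alpha> \<beta>\<^sub>0 \<beta>\<^sub>1 \<beta>\<^sub>2 \<beta>\<^sub>3 \<gamma> z\<^sub>1 z\<^sub>2 z\<^sub>3 :: real
  assumes "0 < \<alpha>" "\<alpha> < \<gamma>" and \<beta>: "0 < \<beta>\<^sub>1" "0 < \<beta>\<^sub>2" "0 < \<beta>\<^sub>3"
    and z: "0 \<le> z\<^sub>1" "z\<^sub>1 < 1" "0 \<le> z\<^sub>2" "z\<^sub>2 < 1" "0 \<le> z\<^sub>3" "z\<^sub>3 < 1"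
  shows "Beta \<alpha> (\<gamma> - \<alpha>) * lauricella_FD \<alpha> \<beta>\<^sub>1 \<beta>\<^sub>2 \<beta>\<^sub>3 \<gamma> z\<^sub>1 z\<^sub>2 z\<^sub>3 =
    euler_integral \<alpha> (\<gamma> - \<alpha>) (quad \<beta>\<^sub>0 \<beta>\<^sub>1 \<beta>\<^sub>2 \<beta>\<^sub>3) (quad 1 (1 - z\<^sub>1) (1 - z\<^sub>2) (1 - z\<^sub>3))"
proof -
  define b where "b = \<gamma> - \<alpha>"
  have b: "b > 0" "\<alpha> + b = \<gamma>"
    using assms by (auto simp: b_def)
  define c where "c = (\<lambda>(i, j, k). pochhammer \<beta>\<^sub>1 i / fact i * z\<^sub>1 ^ i *
    (pochhammer \<beta>\<^sub>2 j / fact j * z\<^sub>2 ^ j * (pochhammer \<beta>\<^sub>3 k / fact k * z\<^sub>3 ^ k)))"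
  define s :: "nat \<times> nat \<times> nat \<Rightarrow> nat" where "s = (\<lambda>(i, j, k). i + j + k)"
  define f where "f i t = c i * beta_weight (\<alpha> + real (s i)) b t" for i t
  define x where "x = quad 1 (1 - z\<^sub>1) (1 - z\<^sub>2) (1 - z\<^sub>3)"
  define F where "F t = beta_weight \<alpha> b t * euler_kernel (quad \<beta>\<^sub>0 \<beta>\<^sub>1 \<beta>\<^sub>2 \<beta>\<^sub>3) x t" for t
  have c_nonneg: "c i \<ge> 0" for i
    unfolding c_def by (cases i) (auto intro!: mult_nonneg_nonneg divide_nonneg_nonneg pochhammer_nonneg \<beta> z zero_le_power)
  have "\<forall>k. x k > 0"
    using z by (simp add: forall_4 x_def)
  then have x: "x k > 0" for k
    by simp
  have pow: "((\<lambda>i. f i t) has_sum F t) UNIV" for t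
  proof (cases "t \<in> {0<..<1}")
    case True
    define g where "g \<beta> z n = pochhammer \<beta> n / fact n * (t * z) ^ n" for \<beta> z :: real and n
    have g: "(g \<beta> z has_sum (1 - t * z) powr (- \<beta>)) UNIV" if "0 < \<beta>" "0 \<le> z" "z < 1" for \<beta> z
      unfolding g_def using that True mult_strict_mono[of t 1 z 1]
      by (intro has_sum_pochhammer_powr) (cases "z = 0", auto)
    have g_nonneg: "g \<beta> z n \<ge> 0" if "0 < \<beta>" "0 \<le> z" for \<beta> z n
      unfolding g_def using that True
      by (intro mult_nonneg_nonneg divide_nonneg_nonneg pochhammer_nonneg zero_le_power) auto
    have "((\<lambda>(j, k). g \<beta>\<^sub>2 z\<^sub>2 j * g \<beta>\<^sub>3 z\<^sub>3 k) has_sum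
        (1 - t * z\<^sub>2) powr (- \<beta>\<^sub>2) * (1 - t * z\<^sub>3) powr (- \<beta>\<^sub>3)) (UNIV \<times> UNIV)"
      using z \<beta> by (intro has_sum_product_nonneg[where f = "g \<beta>\<^sub>2 z\<^sub>2" and g = "g \<beta>\<^sub>3 z\<^sub>3"] g g_nonneg)
    from has_sum_product_nonneg[OF g[OF \<beta>(1) z(1,2)] this]
    have "((\<lambda>(i, jk). g \<beta>\<^sub>1 z\<^sub>1 i * (case jk of (j, k) \<Rightarrow> g \<beta>\<^sub>2 z\<^sub>2 j * g \<beta>\<^sub>3 z\<^sub>3 k)) has_sum
        (1 - t * z\<^sub>1) powr (- \<beta>\<^sub>1) * ((1 - t * z\<^sub>2) powr (- \<beta>\<^sub>2) * (1 - t * z\<^sub>3) powr (- \<beta>\<^sub>3)))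
        (UNIV \<times> (UNIV \<times> UNIV))"
      using g_nonneg z \<beta> by auto
    from has_sum_cmult_right[OF this, of "beta_weight \<alpha> b t"]
    have "((\<lambda>i. beta_weight \<alpha> b t * (case i of (i, jk) \<Rightarrow>
        g \<beta>\<^sub>1 z\<^sub>1 i * (case jk of (j, k) \<Rightarrow> g \<beta>\<^sub>2 z\<^sub>2 j * g \<beta>\<^sub>3 z\<^sub>3 k))) has_sum beta_weight \<alpha> b t *
        ((1 - t * z\<^sub>1) powr (- \<beta>\<^sub>1) * ((1 - t * z\<^sub>2) powr (- \<beta>\<^sub>2) * (1 - t * z\<^sub>3) powr (- \<beta>\<^sub>3)))) UNIV"
      by simp
    moreover have "beta_weight \<alpha> b t * (case i of (i, jk) \<Rightarrow>
        g \<beta>\<^sub>1 z\<^sub>1 i * (case jk of (j, k) \<Rightarrow> g \<beta>\<^sub>2 z\<^sub>2 j * g \<beta>\<^sub>3 z\<^sub>3 k)) = f i t" for i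
    proof (cases i)
      case (fields i j k)
      have "w * (p1 * (t ^ i * u1) * (p2 * (t ^ j * u2) * (p3 * (t ^ k * u3)))) =
          p1 * u1 * (p2 * u2 * (p3 * u3)) * (t ^ (i + j + k) * w)" for w p1 p2 p3 u1 u2 u3
        by (simp add: power_add)
      then show ?thesis
        unfolding fields f_def c_def s_def g_def prod.case beta_weight_add power_mult_distrib .
    qed
    ultimately have "((\<lambda>i. f i t) has_sum beta_weight \<alpha> b t *
        ((1 - t * z\<^sub>1) powr (- \<beta>\<^sub>1) * ((1 - t * z\<^sub>2) powr (- \<beta>\<^sub>2) * (1 - t * z\<^sub>3) powr (- \<beta>\<^sub>3)))) UNIV"
      by simp
    moreover have "euler_kernel (quad \<beta>\<^sub>0 \<beta>\<^sub>1 \<beta>\<^sub>2 \<beta>\<^sub>3) x t =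
        (1 - t * z\<^sub>1) powr (- \<beta>\<^sub>1) * ((1 - t * z\<^sub>2) powr (- \<beta>\<^sub>2) * (1 - t * z\<^sub>3) powr (- \<beta>\<^sub>3))"
    proof -
      have eq: "1 - t + t * (1 - z) = 1 - t * z" for z
        by (simp add: algebra_simps)
      show ?thesis
        unfolding euler_kernel_def x_def prod_4 quad_simps eq by simp
    qed
    ultimately show ?thesis
      by (simp add: F_def)
  qed (simp add: f_def F_def beta_weight_eq_0)
  have "((\<lambda>i. integral\<^sup>L lborel (f i)) has_sum integral\<^sup>L lborel F) UNIV"
  proof (rule has_sum_integral_nonneg)
    show "integrable lborel (f i)" for i
      unfolding f_def using has_bochner_integral_beta_weight[of "\<alpha> + real (s i)" b] assms(1) b
      by (intro integrable_mult_right) (auto simp: has_bochner_integral_iff)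
    show "integrable lborel F"
      unfolding F_def using assms(1) b x by (intro integrable_euler_kernel) auto
    show "infinite (UNIV :: (nat \<times> nat \<times> nat) set)"
      by (simp add: finite_prod)
  qed (use pow c_nonneg in \<open>auto simp: f_def beta_weight_nonneg\<close>)
  then have "integral\<^sup>L lborel F = (\<Sum>\<^sub>\<infinity>i. integral\<^sup>L lborel (f i))"
    by (simp add: infsumI)
  also have "\<dots> = (\<Sum>\<^sub>\<infinity>i. Beta \<alpha> b * (c i * pochhammer \<alpha> (s i) / pochhammer \<gamma> (s i)))"
  proof (rule infsum_cong)
    fix i
    have "integral\<^sup>L lborel (f i) = c i * Beta (\<alpha> + real (s i)) b"
      unfolding f_def using has_bochner_integral_beta_weight[of "\<alpha> + real (s i)" b] assms(1) b
      by (simp add: has_bochner_integral_iff)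
    then show "integral\<^sup>L lborel (f i) = Beta \<alpha> b * (c i * pochhammer \<alpha> (s i) / pochhammer \<gamma> (s i))"
      using Beta_add_nat[of \<alpha> b "s i"] assms(1) b by (simp add: mult_ac)
  qed
  also have "\<dots> = Beta \<alpha> b * (\<Sum>\<^sub>\<infinity>i. c i * pochhammer \<alpha> (s i) / pochhammer \<gamma> (s i))"
    by (rule infsum_cmult_right')
  also have "(\<Sum>\<^sub>\<infinity>i. c i * pochhammer \<alpha> (s i) / pochhammer \<gamma> (s i)) =
      lauricella_FD \<alpha> \<beta>\<^sub>1 \<beta>\<^sub>2 \<beta>\<^sub>3 \<gamma> z\<^sub>1 z\<^sub>2 z\<^sub>3"
    unfolding lauricella_FD_def
    by (intro infsum_cong) (auto simp: c_def s_def pochhammer_fact mult_ac)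
  finally show ?thesis
    by (simp add: F_def[abs_def] x_def b_def euler_integral_def)
qed

section \<open>The iteration\<close>

lemma Beta_real_pos: "a > 0 \<Longrightarrow> b > 0 \<Longrightarrow> Beta a b > (0 :: real)"
  by (simp add: Beta_def)

text \<open>Degree -1/4 in x becomes degree -1/2 in the scale of the unsquared variables.\<close>

lemma km_period_scale:
  assumes "\<And>k. x k > 0" "s > 0"
  shows "km_period (\<lambda>k. s\<^sup>2 * x k) = s powr (- 1/2) * km_period x"
proof -
  have "km_period (\<lambda>k. s\<^sup>2 * x k) = (s\<^sup>2) powr (- (1/4)) * km_period x"
    unfolding km_period_def using assms by (intro euler_integral_scale) (auto simp: sum_4)
  also have "(s\<^sup>2) powr (- (1/4)) = s powr (- 1/2)"
    using assms by (simp add: powr_powr flip: powr_numeral)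
  finally show ?thesis .
qed

lemma km_period_diagonal:
  assumes "s > 0"
  shows "km_period (\<lambda>_. s\<^sup>2) = s powr (- 1/2) * Beta (1/4) (3/4)"
proof -
  have "km_period (\<lambda>_. 1) = Beta (1/4) (3/4)"
    using has_bochner_integral_beta_weight[of "1/4" "3/4"]
    by (simp add: km_period_def euler_integral_def euler_kernel_def has_bochner_integral_iff)
  then show ?thesis
    using km_period_scale[of "\<lambda>_. 1" s] assms by simp
qed

lemma km_period_antimono:
  assumes "\<And>k. 0 < x k" "\<And>k. x k \<le> y k"
  shows "km_period y \<le> km_period x"
  unfolding km_period_def by (rule euler_integral_antimono) (use assms in auto)

text \<open>The order and the halving of the gap give convergence and the squeeze in the
  limit.\<close>

lemma km_step_bounds:
  assumes "0 < d" "d \<le> c" "c \<le> b" "b \<le> a" and step: "km_step (a, b, c, d) = (a', b', c', d')"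
  shows "0 < d'" "d' \<le> c'" "c' \<le> b'" "b' \<le> a'" "a' \<le> a" "d \<le> d'" "a' - d' \<le> (a - d) / 2"
proof -
  have step: "a' = (a + b + c + d) / 4" "b' = sqrt ((a + d) * (b + c)) / 2"
    "c' = sqrt ((a + c) * (b + d)) / 2" "d' = sqrt ((a + b) * (c + d)) / 2"
    using step by (auto simp: km_step_def)
  show "a' \<le> a"
    using assms by (simp add: step)
  \<comment> \<open>These products are the differences of the radicands: of c' and d' for the first,
    of b' and c' for the second.\<close>
  have "0 \<le> (a - d) * (b - c)" "0 \<le> (a - b) * (c - d)"
    using assms by auto
  then show "d' \<le> c'" "c' \<le> b'"
    by (simp_all add: step algebra_simps)
  have "sqrt ((a + d) * (b + c)) \<le> ((a + d) + (b + c)) / 2"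
    using assms by (intro arith_geo_mean_sqrt) auto
  then show "b' \<le> a'"
    by (simp add: step)
  have "sqrt ((c + d) * (c + d)) \<le> sqrt ((a + b) * (c + d))"
    using assms by (intro real_sqrt_le_mono mult_right_mono) auto
  then have d': "(c + d) / 2 \<le> d'"
    using assms by (simp add: step)
  then show "0 < d'" "d \<le> d'"
    using assms by auto
  have "a' - d' \<le> (a + b + c + d) / 4 - (c + d) / 2"
    using d' by (simp add: step(1))
  also have "\<dots> \<le> (a - d) / 2"
    using assms(2-4) by (simp add: field_simps)
  finally show "a' - d' \<le> (a - d) / 2" .
qed

lemma km_step_period:
  assumes "0 < d" "d \<le> c" "c \<le> b" "b \<le> a" and step: "km_step (a, b, c, d) = (a', b', c', d')"
  shows "km_period (quad (a'\<^sup>2) (b'\<^sup>2) (c'\<^sup>2) (d'\<^sup>2)) = km_period (quad (a\<^sup>2) (b\<^sup>2) (c\<^sup>2) (d\<^sup>2))"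
proof -
  have "quad (a'\<^sup>2) (b'\<^sup>2) (c'\<^sup>2) (d'\<^sup>2) = km_squares (quad a b c d)"
  proof -
    have eqs: "a' = (a + b + c + d) / 4" "b' = sqrt ((a + d) * (b + c)) / 2"
      "c' = sqrt ((a + c) * (b + d)) / 2" "d' = sqrt ((a + b) * (c + d)) / 2"
      using step by (auto simp: km_step_def)
    show ?thesis
      unfolding eqs using assms(1-4) by (simp add: km_squares_def power_divide)
  qed
  moreover have "\<forall>k. quad a b c d k > 0"
    using assms by (simp add: forall_4)
  then have "km_period (km_squares (quad a b c d)) = km_period (\<lambda>k. (quad a b c d k)\<^sup>2)"
    by (intro km_period_invariant) simp
  ultimately show ?thesis
    by (simp add: quad_eta[of "\<lambda>x. x\<^sup>2"])
qed

text \<open>The period stays constant while the four variables merge. By monotonicity it lies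
  between its diagonal values at the largest and the smallest entry, and both tend to the diagonal
  value at the limit.\<close>

theorem M_KM_period:
  assumes "0 < d" "d \<le> c" "c \<le> b" "b \<le> a"
  shows "M_KM a b c d > 0"
    and "km_period (quad (a\<^sup>2) (b\<^sup>2) (c\<^sup>2) (d\<^sup>2)) = M_KM a b c d powr (- 1/2) * Beta (1/4) (3/4)"
proof -
  define P where "P = km_period (quad (a\<^sup>2) (b\<^sup>2) (c\<^sup>2) (d\<^sup>2))"
  define S where "S n = (km_step ^^ n) (a, b, c, d)" for n
  define A B C D where "A n = fst (S n)" and "B n = fst (snd (S n))" and
    "C n = fst (snd (snd (S n)))" and "D n = snd (snd (snd (S n)))" for n
  have S: "S n = (A n, B n, C n, D n)" for n
    by (simp add: A_def B_def C_def D_def)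
  have step: "km_step (A n, B n, C n, D n) = (A (Suc n), B (Suc n), C (Suc n), D (Suc n))" for n
    unfolding S[symmetric] by (simp add: S_def)
  have ord: "d \<le> D n \<and> 0 < D n \<and> D n \<le> C n \<and> C n \<le> B n \<and> B n \<le> A n \<and> A n - D n \<le> (a - d) / 2 ^ n \<and>
      km_period (quad ((A n)\<^sup>2) ((B n)\<^sup>2) ((C n)\<^sup>2) ((D n)\<^sup>2)) = P" for n
  proof (induction n)
    case 0
    then show ?case
      using assms by (simp add: A_def B_def C_def D_def S_def P_def)
  next
    case (Suc n)
    then have "A (Suc n) - D (Suc n) \<le> (a - d) / 2 ^ n / 2"
      using km_step_bounds(7)[OF _ _ _ _ step[of n]] by auto
    also have "\<dots> = (a - d) / 2 ^ Suc n"
      by simp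
    finally show ?case
      using Suc km_step_bounds(1-6)[OF _ _ _ _ step[of n]] km_step_period[OF _ _ _ _ step[of n]]
      by auto
  qed
  have "decseq A"
    using km_step_bounds(5)[OF _ _ _ _ step] ord by (intro decseq_SucI) auto
  moreover have "\<forall>n. d \<le> A n"
    using ord by (meson order.trans)
  ultimately obtain L where L: "A \<longlonglongrightarrow> L" "\<forall>n. L \<le> A n"
    by (metis decseq_convergent)
  have "L \<ge> d"
    using L(1) \<open>\<forall>n. d \<le> A n\<close> by (intro LIMSEQ_le_const) auto
  then have "L > 0"
    using assms by simp
  \<comment> \<open>The halved gaps give a lower barrier with the same limit as \<open>A\<close>,
    which squeezes the other three sequences.\<close>
  have "(\<lambda>n. A n - (a - d) / 2 ^ n) \<longlonglongrightarrow> L - 0"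
    by (intro tendsto_diff L(1) LIMSEQ_divide_realpow_zero) simp
  then have lower: "(\<lambda>n. A n - (a - d) / 2 ^ n) \<longlonglongrightarrow> L"
    by simp
  have bounds: "A n - (a - d) / 2 ^ n \<le> D n \<and> D n \<le> C n \<and> C n \<le> B n \<and> B n \<le> A n" for n
    using ord[of n] by linarith
  have sandwich: "X \<longlonglongrightarrow> L" if "\<And>n. A n - (a - d) / 2 ^ n \<le> X n \<and> X n \<le> A n" for X
    by (rule real_tendsto_sandwich[OF _ _ lower L(1)]) (use that in auto)
  have lims: "B \<longlonglongrightarrow> L" "C \<longlonglongrightarrow> L" "D \<longlonglongrightarrow> L"
    by (rule sandwich; use bounds in \<open>meson order.trans\<close>)+
  have conv: "(\<lambda>n. (km_step ^^ n) (a, b, c, d)) \<longlonglongrightarrow> (L, L, L, L)"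
    unfolding S_def[symmetric] S by (intro tendsto_Pair L(1) lims)
  have M: "M_KM a b c d = L"
    unfolding M_KM_def
  proof (rule the_equality)
    show "(\<lambda>n. (km_step ^^ n) (a, b, c, d)) \<longlonglongrightarrow> (L, L, L, L)"
      by (rule conv)
    fix L' assume "(\<lambda>n. (km_step ^^ n) (a, b, c, d)) \<longlonglongrightarrow> (L', L', L', L')"
    from LIMSEQ_unique[OF this conv] show "L' = L"
      by simp
  qed
  then show "M_KM a b c d > 0"
    using \<open>L > 0\<close> by simp
  let ?f = "\<lambda>s :: real. s powr (- 1/2) * Beta (1/4) (3/4)"
  have f_tendsto: "(\<lambda>n. ?f (X n)) \<longlonglongrightarrow> ?f L" if "X \<longlonglongrightarrow> L" for X
    using that \<open>L > 0\<close> by (intro tendsto_intros) auto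
  have "?f (A n) \<le> P" for n
  proof -
    have "\<forall>k. quad ((A n)\<^sup>2) ((B n)\<^sup>2) ((C n)\<^sup>2) ((D n)\<^sup>2) k > 0 \<and>
        quad ((A n)\<^sup>2) ((B n)\<^sup>2) ((C n)\<^sup>2) ((D n)\<^sup>2) k \<le> (A n)\<^sup>2"
      unfolding forall_4 using ord[of n] by (auto intro!: power_mono)
    then have "km_period (\<lambda>_. (A n)\<^sup>2) \<le> km_period (quad ((A n)\<^sup>2) ((B n)\<^sup>2) ((C n)\<^sup>2) ((D n)\<^sup>2))"
      by (intro km_period_antimono) auto
    then show ?thesis
      using ord[of n] km_period_diagonal[of "A n"] by simp
  qed
  then have "?f L \<le> P"
    using f_tendsto[OF L(1)] by (intro LIMSEQ_le_const2) auto
  moreover have "P \<le> ?f (D n)" for n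
  proof -
    have "\<forall>k. (D n)\<^sup>2 \<le> quad ((A n)\<^sup>2) ((B n)\<^sup>2) ((C n)\<^sup>2) ((D n)\<^sup>2) k"
      unfolding forall_4 using ord[of n] by (auto intro!: power_mono)
    then have "km_period (quad ((A n)\<^sup>2) ((B n)\<^sup>2) ((C n)\<^sup>2) ((D n)\<^sup>2)) \<le> km_period (\<lambda>_. (D n)\<^sup>2)"
      using ord[of n] by (intro km_period_antimono) auto
    then show ?thesis
      using ord[of n] km_period_diagonal[of "D n"] by simp
  qed
  then have "P \<le> ?f L"
    using f_tendsto[OF lims(3)] by (intro LIMSEQ_le_const) auto
  ultimately show "km_period (quad (a\<^sup>2) (b\<^sup>2) (c\<^sup>2) (d\<^sup>2)) = M_KM a b c d powr (- 1/2) * Beta (1/4) (3/4)"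
    using M by (simp add: P_def)
qed

text \<open>The period at the squares is evaluated twice: by the iteration as M^(-1/2) \<beta>, and
  by scaling the first variable to 1 as a^(-1/2) \<beta> F. Squaring removes the half
  powers.\<close>

theorem corollary5p8:
  fixes a b c d :: real
  assumes "0 < d" and "d \<le> c" and "c \<le> b" and "b \<le> a"
  shows "a / M_KM a b c d =
    (lauricella_FD (1/4) (1/4) (1/4) (1/4) 1
       (1 - b\<^sup>2 / a\<^sup>2) (1 - c\<^sup>2 / a\<^sup>2) (1 - d\<^sup>2 / a\<^sup>2))\<^sup>2"
proof -
  define F where "F = lauricella_FD (1/4) (1/4) (1/4) (1/4) 1
    (1 - b\<^sup>2 / a\<^sup>2) (1 - c\<^sup>2 / a\<^sup>2) (1 - d\<^sup>2 / a\<^sup>2)"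
  define M where "M = M_KM a b c d"
  define \<beta> where "\<beta> = Beta (1/4) (3/4 :: real)"
  have pos: "a > 0" "b > 0" "c > 0" "\<beta> > 0" "M > 0"
    using assms M_KM_period(1)[OF assms] by (auto simp: M_def \<beta>_def Beta_real_pos)
  have ratio: "0 \<le> 1 - x\<^sup>2 / a\<^sup>2 \<and> 1 - x\<^sup>2 / a\<^sup>2 < 1" if "0 < x" "x \<le> a" for x
    using that pos power_mono[of x a 2] by simp
  have quarter: "quad (1/4) (1/4) (1/4) (1/4) = (\<lambda>_. 1/4)"
    by (simp add: fun_eq_iff forall_4)
  have "\<beta> * F = euler_integral (1/4) (3/4) (quad (1/4) (1/4) (1/4) (1/4))
      (quad 1 (1 - (1 - b\<^sup>2 / a\<^sup>2)) (1 - (1 - c\<^sup>2 / a\<^sup>2)) (1 - (1 - d\<^sup>2 / a\<^sup>2)))"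
    using lauricella_FD_euler_integral[of "1/4" 1 "1/4" "1/4" "1/4" "1 - b\<^sup>2 / a\<^sup>2" "1 - c\<^sup>2 / a\<^sup>2"
        "1 - d\<^sup>2 / a\<^sup>2" "1/4"] ratio[of b] ratio[of c] ratio[of d] assms pos
    by (simp add: F_def \<beta>_def)
  also have "\<dots> = km_period (quad 1 (b\<^sup>2 / a\<^sup>2) (c\<^sup>2 / a\<^sup>2) (d\<^sup>2 / a\<^sup>2))"
    by (simp add: quarter km_period_def)
  finally have F: "km_period (quad 1 (b\<^sup>2 / a\<^sup>2) (c\<^sup>2 / a\<^sup>2) (d\<^sup>2 / a\<^sup>2)) = \<beta> * F" ..
  have "M powr (- 1/2) * \<beta> = km_period (quad (a\<^sup>2) (b\<^sup>2) (c\<^sup>2) (d\<^sup>2))"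
    using M_KM_period(2)[OF assms] by (simp add: M_def \<beta>_def)
  also have "quad (a\<^sup>2) (b\<^sup>2) (c\<^sup>2) (d\<^sup>2) = (\<lambda>k. a\<^sup>2 * quad 1 (b\<^sup>2 / a\<^sup>2) (c\<^sup>2 / a\<^sup>2) (d\<^sup>2 / a\<^sup>2) k)"
    using pos by (simp add: fun_eq_iff forall_4)
  also have "km_period \<dots> = a powr (- 1/2) * (\<beta> * F)"
  proof -
    have "\<forall>k. quad 1 (b\<^sup>2 / a\<^sup>2) (c\<^sup>2 / a\<^sup>2) (d\<^sup>2 / a\<^sup>2) k > 0"
      using pos assms by (simp add: forall_4)
    then show ?thesis
      using pos by (subst km_period_scale) (auto simp: F)
  qed
  finally have "M powr (- 1/2) = a powr (- 1/2) * F"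
    using pos by simp
  then have "(M powr (- 1/2))\<^sup>2 = (a powr (- 1/2))\<^sup>2 * F\<^sup>2"
    by (simp add: power_mult_distrib)
  moreover have inv: "(s powr (- 1/2))\<^sup>2 = 1 / s" if "s > 0" for s :: real
  proof -
    have "(s powr (- 1/2))\<^sup>2 = s powr (- 1)"
      unfolding power2_eq_square powr_add[symmetric] by simp
    then show ?thesis
      using that by (simp add: powr_minus_divide)
  qed
  ultimately have "a / M = F\<^sup>2"
    unfolding inv[OF pos(1)] inv[OF pos(5)] using pos by (simp add: field_simps)
  then show ?thesis
    by (simp only: F_def M_def)
qed

end
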